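(* Let $T>0$, let $A:\mathbb{R}\to\mathbb{R}^{n\times n}$ be continuous and $T$-periodic, and consider the linear system $\dot{\mathbf x}=A(t)\mathbf x$, $\mathbf x\in\mathbb{R}^n$. Let $d\in\mathbb{N}$ be the A-index of this system. Then there exist a real matrix $R\in\mathbb{R}^{n\times n}$ and a real matrix function $Q:\mathbb{R}\to\mathbb{R}^{n\times n}$ such that $\Phi(t):=Q(t)e^{tR}$ is a fundamental matrix solution of $\dot{\mathbf x}=A(t)\mathbf x$ and \[ Q(t+T)=Q(t)\,\big[I_{n-d}\oplus(-I_d)\big]\quad\text{for all } t\in\mathbb{R}. \] In particular, the change of variables $\mathbf y=Q^{-1}(t)\mathbf x$ transforms $\dot{\mathbf x}=A(t)\mathbf x$ into the real constant-coefficient system $\dot{\mathbf y}=R\mathbf y$.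
   Context: For a fundamental matrix solution $\Phi(t)$ of $\dot{\mathbf x}=A(t)\mathbf x$, the matrix $\Phi^{-1}(0)\Phi(T)$ is called a monodromy matrix; its Jordan normal form does not depend on the choice of $\Phi$. The A-index (antiperiodicity index) of the system is defined as follows: consider the (complex) Jordan normal form of a monodromy matrix; for each distinct Jordan block associated to a real negative eigenvalue which occurs an odd number of times in this Jordan form, take its dimension (counting each such distinct block only once, regardless of how many times it occurs); the A-index is the sum of these dimensions. $I_m$ denotes the $m\times m$ identity matrix and $\oplus$ denotes the block-diagonal direct sum of square matrices. *)

theory Defs
  imports "HOL-Analysis.Analysis" "Jordan_Normal_Form.Jordan_Normal_Form_Uniqueness"
begin

definition mat_exp_t :: "nat \<Rightarrow> real \<Rightarrow> real mat \<Rightarrow> real mat" where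
  "mat_exp_t n t R = mat n n (\<lambda>(i,j). \<Sum>k. (t ^ k / fact k) * (R ^\<^sub>m k) $$ (i,j))"

definition fundamental_matrix :: "nat \<Rightarrow> (real \<Rightarrow> real mat) \<Rightarrow> (real \<Rightarrow> real mat) \<Rightarrow> bool" where
  "fundamental_matrix n A \<Phi> \<longleftrightarrow>
     (\<forall>t. \<Phi> t \<in> carrier_mat n n \<and> det (\<Phi> t) \<noteq> 0 \<and>
        (\<forall>i<n. \<forall>j<n. ((\<lambda>s. \<Phi> s $$ (i,j)) has_real_derivative (A t * \<Phi> t) $$ (i,j)) (at t)))"

definition monodromy :: "nat \<Rightarrow> (real \<Rightarrow> real mat) \<Rightarrow> real \<Rightarrow> real mat" where
  "monodromy n \<Phi> T = (THE M. M \<in> carrier_mat n n \<and> \<Phi> 0 * M = \<Phi> T)"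

definition aindex_mat :: "real mat \<Rightarrow> nat" where
  "aindex_mat M = (let n_as = (SOME n_as. jordan_nf (map_mat complex_of_real M) n_as) in
     \<Sum>b \<in> {b \<in> set n_as. snd b \<in> \<real> \<and> Re (snd b) < 0 \<and> odd (count_list n_as b)}. fst b)"

text \<open>A-index of the system x' = A(t) x with period T (computed from some fundamental matrix;
  it does not depend on the choice).\<close>
definition A_index :: "nat \<Rightarrow> (real \<Rightarrow> real mat) \<Rightarrow> real \<Rightarrow> nat" where
  "A_index n A T = aindex_mat (monodromy n (SOME \<Phi>. fundamental_matrix n A \<Phi>) T)"

definition sign_block :: "nat \<Rightarrow> nat \<Rightarrow> real mat" where
  "sign_block n d = four_block_mat (1\<^sub>m (n - d)) (0\<^sub>m (n - d) d) (0\<^sub>m d (n - d)) (- (1\<^sub>m d))"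

end

theory Submission
  imports Defs "Jordan_Normal_Form.Jordan_Normal_Form_Existence"
begin

text \<open>
  Let \<open>M\<close> be the monodromy matrix of a fundamental matrix \<open>\<Phi>\<close>. If \<open>M = W S e\<^bsup>TR\<^esup> W\<^sup>-\<^sup>1\<close> for real
  matrices \<open>W\<close>, \<open>R\<close> and \<open>S = I\<^bsub>n-d\<^esub> \<oplus> (-I\<^sub>d)\<close> with \<open>S R = R S\<close>, then \<open>Q(t) = \<Phi>(t) W e\<^bsup>-tR\<^esup>\<close> does what
  is wanted. To find such a factorisation it suffices to produce a real matrix
  \<open>e\<^bsup>TR1\<^esup> \<oplus> (- e\<^bsup>TR2\<^esup>)\<close> with the complex Jordan form of \<open>M\<close>, because real matrices that are
  similar over the complex numbers are similar over the reals.

  A Jordan block with positive eigenvalue is similar to the exponential of a real Jordan block.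
  The remaining blocks with non-real or negative eigenvalue come in conjugate pairs, except for one
  copy of each negative block of odd multiplicity; a pair is the exponential of the real form of a
  complex Jordan block. The exceptional copies have total size \<open>d\<close> and become positive after
  a change of sign, so they are put into \<open>- e\<^bsup>TR2\<^esup>\<close>.

  Solutions are given by the Peano--Baker series. A solution of the adjoint equation
  \<open>\<Psi>' = - \<Psi> A\<close> makes every product \<open>\<Psi> \<Phi>\<close> constant, which yields both the invertibility of \<open>\<Phi>\<close>
  and uniqueness.
\<close>

section \<open>Direct sums and Jordan matrices\<close>

lemma mat_inverse_exists:
  fixes A :: "'a::field mat"
  assumes "A \<in> carrier_mat n n" "det A \<noteq> 0"
  shows "\<exists>B. B \<in> carrier_mat n n \<and> A * B = 1\<^sub>m n \<and> B * A = 1\<^sub>m n"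
  using det_non_zero_imp_unit[OF assms, of undefined] unfolding Units_def ring_mat_def by auto

text \<open>The sizes of the zero blocks are read off from \<open>A\<close> and \<open>B\<close>, so
  associativity holds without carrier assumptions and iterated sums need no dimension
  arguments.\<close>

definition dirsum :: "'a::zero mat \<Rightarrow> 'a mat \<Rightarrow> 'a mat" where
  "dirsum A B =
     four_block_mat A (0\<^sub>m (dim_row A) (dim_col B)) (0\<^sub>m (dim_row B) (dim_col A)) B"

lemma dirsum_carrier_mat [simp, intro]:
  "A \<in> carrier_mat n n \<Longrightarrow> B \<in> carrier_mat m m \<Longrightarrow> dirsum A B \<in> carrier_mat (n + m) (n + m)"
  unfolding dirsum_def by auto

lemma dirsum_eq:
  "A \<in> carrier_mat n n \<Longrightarrow> B \<in> carrier_mat m m \<Longrightarrow>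
     dirsum A B = four_block_mat A (0\<^sub>m n m) (0\<^sub>m m n) B"
  unfolding dirsum_def by auto

lemma dirsum_index:
  assumes "A \<in> carrier_mat n n" "B \<in> carrier_mat m m" "i < n + m" "j < n + m"
  shows "dirsum A B $$ (i, j) =
    (if i < n then if j < n then A $$ (i, j) else 0
     else if j < n then 0 else B $$ (i - n, j - n))"
  using assms by (auto simp: dirsum_def)

lemma dirsum_assoc: "dirsum A (dirsum B C) = dirsum (dirsum A B) C"
  using assoc_four_block_mat[of A B C] unfolding dirsum_def .

lemma dirsum_mult:
  fixes A :: "'a::semiring_0 mat"
  assumes "A \<in> carrier_mat n n" "C \<in> carrier_mat n n" "B \<in> carrier_mat m m" "D \<in> carrier_mat m m"
  shows "dirsum A B * dirsum C D = dirsum (A * C) (B * D)"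
proof -
  have "dirsum A B * dirsum C D = four_block_mat (A * C + 0\<^sub>m n m * 0\<^sub>m m n)
      (A * 0\<^sub>m n m + 0\<^sub>m n m * D) (0\<^sub>m m n * C + B * 0\<^sub>m m n) (0\<^sub>m m n * 0\<^sub>m n m + B * D)"
    unfolding dirsum_eq[OF assms(1,3)] dirsum_eq[OF assms(2,4)]
    by (rule mult_four_block_mat) (use assms in auto)
  also have "\<dots> = dirsum (A * C) (B * D)"
    using assms by (subst dirsum_eq[of _ n _ m]) auto
  finally show ?thesis .
qed

lemma dirsum_pow:
  assumes "A \<in> carrier_mat n n" "B \<in> carrier_mat m m"
  shows "dirsum A B ^\<^sub>m k = dirsum (A ^\<^sub>m k) (B ^\<^sub>m k)"
  using pow_four_block_mat[OF assms, of k] assms by (simp add: dirsum_def)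

lemma map_mat_dirsum:
  assumes "f 0 = 0" "A \<in> carrier_mat n n" "B \<in> carrier_mat m m"
  shows "map_mat f (dirsum A B) = dirsum (map_mat f A) (map_mat f B)"
  using assms by (intro eq_matI) (auto simp: dirsum_def)

lemma similar_mat_dirsum:
  assumes "similar_mat A A'" "similar_mat B B'"
  shows "similar_mat (dirsum A B) (dirsum A' B')"
proof -
  obtain n where n: "A \<in> carrier_mat n n" "A' \<in> carrier_mat n n"
    using similar_matD[OF assms(1)] by auto
  obtain m where m: "B \<in> carrier_mat m m" "B' \<in> carrier_mat m m"
    using similar_matD[OF assms(2)] by auto
  show ?thesis
    unfolding dirsum_eq[OF n(1) m(1)] dirsum_eq[OF n(2) m(2)]
    by (rule similar_mat_four_block_0_0[OF assms n(1) m(1)])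
qed

text \<open>Conjugation by the block permutation matrix \<open>P\<close> that exchanges the two
  groups of coordinates; \<open>Q\<close> is its inverse.\<close>

lemma similar_mat_dirsum_commute:
  fixes A :: "'a::comm_ring_1 mat"
  assumes A: "A \<in> carrier_mat n n" and B: "B \<in> carrier_mat m m"
  shows "similar_mat (dirsum A B) (dirsum B A)"
proof -
  define P where "P = four_block_mat (0\<^sub>m n m) (1\<^sub>m n) (1\<^sub>m m) (0\<^sub>m m n :: 'a mat)"
  define Q where "Q = four_block_mat (0\<^sub>m m n) (1\<^sub>m m) (1\<^sub>m n) (0\<^sub>m n m :: 'a mat)"
  have P: "P \<in> carrier_mat (n + m) (n + m)" and Q: "Q \<in> carrier_mat (n + m) (n + m)"
    unfolding P_def Q_def by (auto simp: add.commute)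
  have PQ: "P * Q = 1\<^sub>m (n + m)" unfolding P_def Q_def
    by (subst mult_four_block_mat[of _ n m _ n _ m _ _ n _ m]) auto
  have QP: "Q * P = 1\<^sub>m (n + m)" unfolding P_def Q_def
    by (subst mult_four_block_mat[of _ m n _ m _ n _ _ m _ n]) (auto simp: add.commute)
  have "P * dirsum B A = four_block_mat (0\<^sub>m n m) A B (0\<^sub>m m n)"
    unfolding P_def dirsum_eq[OF B A]
    by (subst mult_four_block_mat[of _ n m _ n _ m _ _ m _ n]) (use A B in auto)
  also have "\<dots> * Q = dirsum A B"
    unfolding Q_def dirsum_eq[OF A B]
    by (subst mult_four_block_mat[of _ n m _ n _ m _ _ n _ m]) (use A B in auto)
  finally have "dirsum A B = P * dirsum B A * Q" by simp
  moreover have "dirsum B A \<in> carrier_mat (n + m) (n + m)"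
    using dirsum_carrier_mat[OF B A] by (simp add: add.commute)
  ultimately show ?thesis
    using P Q PQ QP dirsum_carrier_mat[OF A B]
    by (intro similar_matI[of _ _ P Q "n + m"]) auto
qed

lemma jordan_matrix_Cons_dirsum:
  "jordan_matrix ((k, a) # xs) = dirsum (jordan_block k a) (jordan_matrix xs)"
  unfolding jordan_matrix_Cons dirsum_def by simp

lemma jordan_matrix_Nil: "jordan_matrix [] = 0\<^sub>m 0 0"
  unfolding jordan_matrix_def by simp

lemma dirsum_empty_left: "dirsum (0\<^sub>m 0 0) A = A"
  by (rule eq_matI) (auto simp: dirsum_def)

lemma jordan_matrix_append:
  "jordan_matrix (xs @ ys) = dirsum (jordan_matrix xs) (jordan_matrix ys)"
  by (induction xs)
    (auto simp: jordan_matrix_Cons_dirsum dirsum_assoc jordan_matrix_Nil dirsum_empty_left)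

lemmas [trans] = similar_mat_trans

text \<open>Only exchanges of two summands are available, so the head \<open>x\<close> is moved into
  place by two rotations: \<open>us @ vs\<close> becomes \<open>vs @ us\<close>, then
  \<open>x\<close> is put in front, and \<open>(x # vs) @ us\<close> is rotated into
  \<open>us @ x # vs\<close>.\<close>

lemma similar_jordan_matrix_perm:
  fixes xs :: "(nat \<times> 'a::comm_ring_1) list"
  assumes "mset xs = mset ys"
  shows "similar_mat (jordan_matrix xs) (jordan_matrix ys)"
  using assms
proof (induction xs arbitrary: ys)
  case Nil
  then show ?case by (auto intro!: similar_mat_refl[of _ 0] simp: jordan_matrix_Nil)
next
  case (Cons x xs)
  obtain k a where x: "x = (k, a)" by force
  have "x \<in> set ys" using Cons.prems by (metis list.set_intros(1) set_mset_mset)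
  then obtain us vs where ys: "ys = us @ x # vs" by (meson split_list)
  let ?J = "jordan_matrix :: (nat \<times> 'a) list \<Rightarrow> _" and ?x = "jordan_block k a"
  have "mset xs = mset (us @ vs)" using Cons.prems ys by simp
  from Cons.IH[OF this] have "similar_mat (?J xs) (dirsum (?J us) (?J vs))"
    by (simp add: jordan_matrix_append)
  also have "similar_mat (dirsum (?J us) (?J vs)) (dirsum (?J vs) (?J us))"
    by (rule similar_mat_dirsum_commute) auto
  finally have "similar_mat (?J (x # xs)) (dirsum ?x (dirsum (?J vs) (?J us)))"
    unfolding x jordan_matrix_Cons_dirsum
    by (intro similar_mat_dirsum similar_mat_refl[of _ k]) auto
  also have "dirsum ?x (dirsum (?J vs) (?J us)) = dirsum (?J (x # vs)) (?J us)"
    by (simp add: x jordan_matrix_Cons_dirsum dirsum_assoc)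
  also have "similar_mat \<dots> (dirsum (?J us) (?J (x # vs)))"
    by (rule similar_mat_dirsum_commute) auto
  also have "dirsum (?J us) (?J (x # vs)) = ?J ys"
    by (simp add: ys jordan_matrix_append)
  finally show ?case .
qed

section \<open>Powers of strictly upper triangular matrices and recognition of Jordan blocks\<close>

lemma mult_mat_index_sum:
  assumes "A \<in> carrier_mat n m" "B \<in> carrier_mat m p" "i < n" "j < p"
  shows "(A * B) $$ (i, j) = (\<Sum>l<m. A $$ (i, l) * B $$ (l, j))"
  using assms by (auto simp: scalar_prod_def lessThan_atLeast0)

lemma pow_mat_Suc_left:
  fixes A :: "'a::semiring_1 mat"
  assumes "A \<in> carrier_mat n n"
  shows "A ^\<^sub>m Suc k = A * A ^\<^sub>m k"
proof (induction k)
  case (Suc k)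
  then show ?case using assms by (simp add: assoc_mult_mat[of _ n n _ n _ n])
qed (use assms in auto)

text \<open>Each factor \<open>N\<close> moves the support one diagonal up. On the
  \<open>r\<close>-th superdiagonal the entries of the power are products of \<open>r\<close>
  superdiagonal entries of \<open>N\<close>, hence nonzero.\<close>

lemma strictly_upper_pow:
  fixes N :: "'a::field mat"
  assumes N: "N \<in> carrier_mat n n"
    and z: "\<And>i j. i < n \<Longrightarrow> j < n \<Longrightarrow> j \<le> i \<Longrightarrow> N $$ (i, j) = 0"
    and s: "\<And>i. Suc i < n \<Longrightarrow> N $$ (i, Suc i) \<noteq> 0"
  shows "(\<forall>i<n. \<forall>j<n. j < i + r \<longrightarrow> (N ^\<^sub>m r) $$ (i, j) = 0) \<and>
         (\<forall>i. i + r < n \<longrightarrow> (N ^\<^sub>m r) $$ (i, i + r) \<noteq> 0)"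
proof (induction r)
  case 0
  then show ?case using N by auto
next
  case (Suc r)
  have eq: "(N ^\<^sub>m Suc r) $$ (i, j) = (\<Sum>l<n. (N ^\<^sub>m r) $$ (i, l) * N $$ (l, j))"
    if "i < n" "j < n" for i j
    using that N by (simp only: pow_mat.simps) (rule mult_mat_index_sum, auto)
  have "(N ^\<^sub>m Suc r) $$ (i, j) = 0" if "i < n" "j < n" "j < i + Suc r" for i j
    unfolding eq[OF that(1,2)]
  proof (rule sum.neutral, safe)
    fix l assume l: "l < n"
    show "(N ^\<^sub>m r) $$ (i, l) * N $$ (l, j) = 0"
      using Suc.IH z[OF l that(2)] l that by (cases "l < i + r") auto
  qed
  moreover have "(N ^\<^sub>m Suc r) $$ (i, i + Suc r) \<noteq> 0" if "i + Suc r < n" for i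
  proof -
    \<comment> \<open>Only \<open>l = i + r\<close> contributes: for smaller \<open>l\<close> the
      power vanishes, for larger \<open>l\<close> the factor \<open>N\<close> does.\<close>
    have "(N ^\<^sub>m Suc r) $$ (i, i + Suc r)
        = (\<Sum>l\<in>{i + r}. (N ^\<^sub>m r) $$ (i, l) * N $$ (l, i + Suc r))"
      unfolding eq[of i "i + Suc r", OF _ that, simplified]
    proof (subst eq)
      show "(\<Sum>l<n. (N ^\<^sub>m r) $$ (i, l) * N $$ (l, i + Suc r))
          = (\<Sum>l\<in>{i + r}. (N ^\<^sub>m r) $$ (i, l) * N $$ (l, i + Suc r))"
      proof (rule sum.mono_neutral_right)
        show "\<forall>l\<in>{..<n} - {i + r}. (N ^\<^sub>m r) $$ (i, l) * N $$ (l, i + Suc r) = 0"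
        proof
          fix l assume l: "l \<in> {..<n} - {i + r}"
          show "(N ^\<^sub>m r) $$ (i, l) * N $$ (l, i + Suc r) = 0"
            using Suc.IH z[of l "i + Suc r"] l that by (cases "l < i + r") auto
        qed
      qed (use that in auto)
    qed (use that in auto)
    also have "\<dots> \<noteq> 0" using Suc.IH s[of "i + r"] that by auto
    finally show ?thesis .
  qed
  ultimately show ?case by blast
qed

text \<open>The chain \<open>N\<^sup>k\<^sup>-\<^sup>1 e, \<dots>, N e, e\<close> of the last unit vector under the nilpotent part
  is a Jordan basis.\<close>

lemma upper_triangular_similar_jordan_block:
  fixes B :: "'a::field mat"
  assumes B: "B \<in> carrier_mat n n"
    and z: "\<And>i j. i < n \<Longrightarrow> j < i \<Longrightarrow> B $$ (i, j) = 0"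
    and d: "\<And>i. i < n \<Longrightarrow> B $$ (i, i) = a"
    and s: "\<And>i. Suc i < n \<Longrightarrow> B $$ (i, Suc i) \<noteq> 0"
  shows "similar_mat B (jordan_block n a)"
proof (cases "n = 0")
  case True
  then show ?thesis using B by (intro similar_mat_refl[of B 0, THEN back_subst[of "similar_mat B"]]) auto
next
  case False
  define N where "N = mat n n (\<lambda>(i, j). if i = j then 0 else B $$ (i, j))"
  have N: "N \<in> carrier_mat n n" unfolding N_def by simp
  have BN: "B = a \<cdot>\<^sub>m 1\<^sub>m n + N"
    using B d by (intro eq_matI) (auto simp: N_def)
  note up = strictly_upper_pow[OF N, of r for r]
  have up0: "(N ^\<^sub>m r) $$ (i, j) = 0" if "i < n" "j < n" "j < i + r" for i j r
    using up[of r] z s that by (auto simp: N_def)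
  have up1: "(N ^\<^sub>m r) $$ (i, i + r) \<noteq> 0" if "i + r < n" for i r
    using up[of r] z s that by (auto simp: N_def)
  \<comment> \<open>Column \<open>j\<close> is \<open>N\<close> to the power
    \<open>n - 1 - j\<close> applied to the last unit vector. Its diagonal entry lies on a
    superdiagonal where that power is nonzero, so \<open>P\<close> is triangular and
    invertible.\<close>
  define P where "P = mat n n (\<lambda>(i, j). (N ^\<^sub>m (n - 1 - j)) $$ (i, n - 1))"
  have P: "P \<in> carrier_mat n n" unfolding P_def by simp
  have "upper_triangular P" unfolding P_def upper_triangular_def by (auto intro!: up0)
  moreover have "0 \<notin> set (diag_mat P)"
  proof
    assume "0 \<in> set (diag_mat P)"
    then obtain i where i: "i < n" "P $$ (i, i) = 0" using P by (auto simp: diag_mat_def)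
    then show False using up1[of i "n - 1 - i"] by (auto simp: P_def)
  qed
  ultimately have "det P \<noteq> 0" using det_upper_triangular[OF _ P] by (simp add: prod_list_zero_iff)
  from mat_inverse_exists[OF P this] obtain Q where
    Q: "Q \<in> carrier_mat n n" "P * Q = 1\<^sub>m n" "Q * P = 1\<^sub>m n" by blast
  have NP: "N * P = P * jordan_block n 0"
  proof (rule eq_matI)
    fix i j assume "i < dim_row (P * jordan_block n 0)" "j < dim_col (P * jordan_block n 0)"
    then have ij: "i < n" "j < n" using P by auto
    have "(N * P) $$ (i, j) = (\<Sum>l<n. N $$ (i, l) * (N ^\<^sub>m (n - 1 - j)) $$ (l, n - 1))"
      using ij P N by (subst mult_mat_index_sum[OF N P]) (auto simp: P_def)
    also have "\<dots> = (N * N ^\<^sub>m (n - 1 - j)) $$ (i, n - 1)"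
      using ij N False by (subst mult_mat_index_sum[OF N, of _ n]) auto
    also have "\<dots> = (N ^\<^sub>m (n - j)) $$ (i, n - 1)"
      using ij by (subst pow_mat_Suc_left[OF N, symmetric]) (metis Suc_diff_Suc diff_Suc_eq_diff_pred)
    finally have 1: "(N * P) $$ (i, j) = (N ^\<^sub>m (n - j)) $$ (i, n - 1)" .
    have 2: "(P * jordan_block n 0) $$ (i, j)
        = (\<Sum>l<n. if Suc l = j then P $$ (i, l) else 0)"
      using ij by (subst mult_mat_index_sum[OF P, of _ n]) (auto intro!: sum.cong)
    show "(N * P) $$ (i, j) = (P * jordan_block n 0) $$ (i, j)"
    proof (cases j)
      \<comment> \<open>The first column is the end of the chain: \<open>N\<close> maps it to the
        last column of the \<open>n\<close>-th power of \<open>N\<close>, which is zero.\<close>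
      case 0
      then show ?thesis using 1 2 up0[of i "n - 1" n] ij by auto
    next
      case (Suc m)
      then have "(\<Sum>l<n. if Suc l = j then P $$ (i, l) else 0) = P $$ (i, m)"
        using ij by (simp add: sum.delta)
      then show ?thesis using 1 2 Suc ij by (simp add: P_def)
    qed
  qed (use N P in auto)
  have J: "jordan_block n a = a \<cdot>\<^sub>m 1\<^sub>m n + jordan_block n 0"
    by (rule eq_matI) auto
  have "B * P = P * jordan_block n a"
    unfolding BN J using P N NP
    by (simp add: add_mult_distrib_mat[of _ n n] mult_add_distrib_mat[of _ n n _ n]
        mult_smult_assoc_mat[of _ n n] mult_smult_distrib[of _ n n _ n])
  then have "P * jordan_block n a * Q = B * P * Q" by simp
  also have "\<dots> = B" using B P Q by (simp add: assoc_mult_mat[of _ n n _ n _ n])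
  finally show ?thesis using B P Q
    by (intro similar_matI[of _ _ P Q n]) auto
qed

section \<open>The matrix exponential\<close>

text \<open>A version of \<open>mat_exp_t\<close> that also covers complex matrices, where the
  Jordan blocks live; the dimension is taken from \<open>R\<close>.\<close>

definition mexp :: "real \<Rightarrow> 'a::{real_normed_field,banach} mat \<Rightarrow> 'a mat" where
  "mexp t R = mat (dim_row R) (dim_row R) (\<lambda>(i, j). \<Sum>k. (t ^ k / fact k) *\<^sub>R (R ^\<^sub>m k) $$ (i, j))"

lemma mexp_carrier_mat [simp, intro]: "R \<in> carrier_mat n n \<Longrightarrow> mexp t R \<in> carrier_mat n n"
  unfolding mexp_def by auto

lemma mexp_dim [simp]: "dim_row (mexp t R) = dim_row R" "dim_col (mexp t R) = dim_row R"
  unfolding mexp_def by auto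

lemma mat_exp_t_eq_mexp: "R \<in> carrier_mat n n \<Longrightarrow> mat_exp_t n t R = mexp t R"
  unfolding mexp_def mat_exp_t_def by auto

text \<open>If \<open>b\<close> bounds the entries of \<open>R\<close>, then
  \<open>(b * n) ^ k\<close> bounds those of its \<open>k\<close>-th power, so the exponential
  series of \<open>\<bar>t\<bar> * b * n\<close> is a majorant.\<close>

lemma mexp_summable:
  fixes R :: "'a::{real_normed_field,banach} mat"
  assumes R: "R \<in> carrier_mat n n" and ij: "i < n" "j < n"
  shows "summable (\<lambda>k. (t ^ k / fact k) *\<^sub>R (R ^\<^sub>m k) $$ (i, j))"
proof -
  define b where "b = Max {norm (R $$ (i, j)) | i j. i < dim_row R \<and> j < dim_col R}"
  have b: "norm_bound R b" unfolding b_def by (rule norm_bound_max)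
  have bk: "norm_bound (R ^\<^sub>m k) ((b * real n) ^ k)" for k
  proof (induction k)
    case 0
    then show ?case using R by (auto simp: norm_bound_def)
  next
    case (Suc k)
    from norm_bound_mult[OF pow_carrier_mat[OF R] R Suc b]
    show ?case by (simp add: mult_ac)
  qed
  show ?thesis
  proof (rule summable_comparison_test')
    show "summable (\<lambda>k. (\<bar>t\<bar> * (b * real n)) ^ k /\<^sub>R fact k)"
      by (rule summable_exp_generic)
    fix k
    have "norm ((R ^\<^sub>m k) $$ (i, j)) \<le> (b * real n) ^ k"
      using bk[of k] R ij by (auto simp: norm_bound_def)
    then have "\<bar>t\<bar> ^ k / fact k * norm ((R ^\<^sub>m k) $$ (i, j)) \<le> \<bar>t\<bar> ^ k / fact k * (b * real n) ^ k"
      by (intro mult_left_mono) auto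
    then show "norm ((t ^ k / fact k) *\<^sub>R (R ^\<^sub>m k) $$ (i, j)) \<le> (\<bar>t\<bar> * (b * real n)) ^ k /\<^sub>R fact k"
      by (simp add: power_mult_distrib power_abs field_simps)
  qed
qed

lemma mexp_sums:
  fixes R :: "'a::{real_normed_field,banach} mat"
  assumes R: "R \<in> carrier_mat n n" and ij: "i < n" "j < n"
  shows "(\<lambda>k. ((t ^ k / fact k) *\<^sub>R (R ^\<^sub>m k) $$ (i, j))) sums (mexp t R $$ (i, j))"
  using mexp_summable[OF assms, of t] R ij by (simp add: mexp_def summable_sums)

text \<open>Multiplication by a fixed matrix takes finite linear combinations of entries and
  therefore commutes with entrywise series. This and its mirror image serve for conjugating and for
  differentiating the exponential.\<close>

lemma sums_mult_mat_left:
  fixes P :: "'a::real_normed_field mat"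
  assumes P: "P \<in> carrier_mat n n" and S: "S \<in> carrier_mat n n" and F: "\<And>k. F k \<in> carrier_mat n n"
    and sums: "\<And>i j. i < n \<Longrightarrow> j < n \<Longrightarrow> (\<lambda>k. c k *\<^sub>R F k $$ (i, j)) sums (S $$ (i, j))"
    and ij: "i < n" "j < n"
  shows "(\<lambda>k. c k *\<^sub>R (P * F k) $$ (i, j)) sums ((P * S) $$ (i, j))"
proof -
  have "(\<lambda>k. \<Sum>l<n. P $$ (i, l) * (c k *\<^sub>R F k $$ (l, j))) sums (\<Sum>l<n. P $$ (i, l) * S $$ (l, j))"
    by (intro sums_sum sums_mult sums) (use ij in auto)
  then show ?thesis
    using P S F ij by (simp add: mult_mat_index_sum[of _ n n _ n] scaleR_sum_right del: index_mult_mat)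
qed

lemma sums_mult_mat_right:
  fixes P :: "'a::real_normed_field mat"
  assumes P: "P \<in> carrier_mat n n" and S: "S \<in> carrier_mat n n" and F: "\<And>k. F k \<in> carrier_mat n n"
    and sums: "\<And>i j. i < n \<Longrightarrow> j < n \<Longrightarrow> (\<lambda>k. c k *\<^sub>R F k $$ (i, j)) sums (S $$ (i, j))"
    and ij: "i < n" "j < n"
  shows "(\<lambda>k. c k *\<^sub>R (F k * P) $$ (i, j)) sums ((S * P) $$ (i, j))"
proof -
  have "(\<lambda>k. \<Sum>l<n. (c k *\<^sub>R F k $$ (i, l)) * P $$ (l, j)) sums (\<Sum>l<n. S $$ (i, l) * P $$ (l, j))"
    by (intro sums_sum sums_mult2 sums) (use ij in auto)
  then show ?thesis
    using P S F ij by (simp add: mult_mat_index_sum[of _ n n _ n] scaleR_sum_right del: index_mult_mat)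
qed

lemma mexp_eqI:
  fixes R :: "'a::{real_normed_field,banach} mat"
  assumes "R \<in> carrier_mat n n" "E \<in> carrier_mat n n"
    and "\<And>i j. i < n \<Longrightarrow> j < n \<Longrightarrow> (\<lambda>k. (t ^ k / fact k) *\<^sub>R (R ^\<^sub>m k) $$ (i, j)) sums (E $$ (i, j))"
  shows "mexp t R = E"
  using assms by (intro eq_matI) (auto intro: sums_unique2[OF mexp_sums[OF assms(1)]])

text \<open>The same \<open>P\<close> and \<open>Q\<close> conjugate every power, hence every
  partial sum and the limit.\<close>

lemma similar_mat_wit_mexp:
  fixes A :: "'a::{real_normed_field,banach} mat"
  assumes "similar_mat_wit A B P Q"
  shows "similar_mat_wit (mexp t A) (mexp t B) P Q"
proof -
  define n where "n = dim_row A"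
  note w = similar_mat_witD[OF n_def assms]
  have B: "B ^\<^sub>m k \<in> carrier_mat n n" for k using w(5) by simp
  have PB: "P * B ^\<^sub>m k \<in> carrier_mat n n" for k using B w(6) by (rule mult_carrier_mat[rotated])
  have "mexp t A = P * mexp t B * Q"
  proof (rule mexp_eqI[OF w(4)])
    fix i j assume ij: "i < n" "j < n"
    show "(\<lambda>k. (t ^ k / fact k) *\<^sub>R (A ^\<^sub>m k) $$ (i, j)) sums ((P * mexp t B * Q) $$ (i, j))"
      unfolding similar_mat_wit_pow_id[OF assms]
      by (intro sums_mult_mat_right[OF w(7) _ PB _ ij] sums_mult_mat_left[OF w(6) _ B]
          mexp_sums[OF w(5)]) (use w in auto)
  qed (use w in auto)
  with w show ?thesis by (intro similar_mat_witI[of _ _ n]) auto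
qed

lemma similar_mat_mexp:
  fixes A :: "'a::{real_normed_field,banach} mat"
  shows "similar_mat A B \<Longrightarrow> similar_mat (mexp t A) (mexp t B)"
  unfolding similar_mat_def using similar_mat_wit_mexp by blast

lemma mexp_dirsum:
  fixes A :: "'a::{real_normed_field,banach} mat"
  assumes A: "A \<in> carrier_mat n n" and B: "B \<in> carrier_mat m m"
  shows "mexp t (dirsum A B) = dirsum (mexp t A) (mexp t B)"
proof (rule mexp_eqI[OF dirsum_carrier_mat[OF A B]])
  show "dirsum (mexp t A) (mexp t B) \<in> carrier_mat (n + m) (n + m)" using A B by auto
  fix i j assume ij: "i < n + m" "j < n + m"
  have "(\<lambda>k. (t ^ k / fact k) *\<^sub>R dirsum (A ^\<^sub>m k) (B ^\<^sub>m k) $$ (i, j)) sums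
      (dirsum (mexp t A) (mexp t B) $$ (i, j))"
    unfolding dirsum_index[OF pow_carrier_mat[OF A] pow_carrier_mat[OF B] ij]
      dirsum_index[OF mexp_carrier_mat[OF A] mexp_carrier_mat[OF B] ij]
    using ij mexp_sums[OF A, of i j t] mexp_sums[OF B, of "i - n" "j - n" t] by auto
  then show "(\<lambda>k. (t ^ k / fact k) *\<^sub>R (dirsum A B ^\<^sub>m k) $$ (i, j)) sums
      (dirsum (mexp t A) (mexp t B) $$ (i, j))"
    by (simp add: dirsum_pow[OF A B])
qed

lemma map_mat_of_real_mexp:
  fixes R :: "real mat"
  assumes R: "R \<in> carrier_mat n n"
  shows "map_mat complex_of_real (mexp t R) = mexp t (map_mat complex_of_real R)"
proof (rule sym, rule mexp_eqI[of _ n])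
  fix i j assume ij: "i < n" "j < n"
  have "(\<lambda>k. complex_of_real ((t ^ k / fact k) *\<^sub>R (R ^\<^sub>m k) $$ (i, j))) sums
      complex_of_real (mexp t R $$ (i, j))"
    by (rule sums_of_real[OF mexp_sums[OF R ij]])
  moreover have "map_mat complex_of_real R ^\<^sub>m k = map_mat complex_of_real (R ^\<^sub>m k)" for k
    by (rule of_real_hom.mat_hom_pow[OF R, symmetric])
  ultimately show "(\<lambda>k. (t ^ k / fact k) *\<^sub>R (map_mat complex_of_real R ^\<^sub>m k) $$ (i, j)) sums
      (map_mat complex_of_real (mexp t R) $$ (i, j))"
    using ij R by (simp add: scaleR_conv_of_real)
qed (use R in auto)

text \<open>The exponential is upper triangular with \<open>exp (t *\<^sub>R c)\<close> on the
  diagonal and \<open>t\<close> times this value just above it. The latter is nonzero because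
  \<open>t\<close> is, so the result is similar to a single Jordan block.\<close>

lemma mexp_jordan_block:
  fixes c :: "'a::{real_normed_field,banach}"
  assumes "t \<noteq> 0"
  shows "similar_mat (mexp t (jordan_block n c)) (jordan_block n (exp (t *\<^sub>R c)))"
proof (rule upper_triangular_similar_jordan_block)
  let ?E = "mexp t (jordan_block n c)"
  show "?E \<in> carrier_mat n n" by auto
  have entry: "?E $$ (i, j) = (\<Sum>k. (t ^ k / fact k) *\<^sub>R
      (if i \<le> j then of_nat (k choose (j - i)) * c ^ (k + i - j) else 0))" if "i < n" "j < n" for i j
    using that by (simp add: mexp_def jordan_block_pow)
  show "?E $$ (i, j) = 0" if "i < n" "j < i" for i j
    using that by (simp add: entry)
  have e: "(\<lambda>k. (t ^ k / fact k) *\<^sub>R c ^ k) sums exp (t *\<^sub>R c)"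
    using exp_converges[of "t *\<^sub>R c"]
    by (simp add: scaleR_power divide_inverse mult.commute)
  show "?E $$ (i, i) = exp (t *\<^sub>R c)" if "i < n" for i
    using that sums_unique[OF e] by (simp add: entry)
  have "?E $$ (i, Suc i) = t *\<^sub>R exp (t *\<^sub>R c)" if "Suc i < n" for i
  proof -
    let ?f = "\<lambda>k. (t ^ k / fact k) *\<^sub>R (of_nat k * c ^ (k - 1))"
    \<comment> \<open>The term \<open>?f 0\<close> is zero, and cancelling \<open>Suc k\<close>
      against the factorial leaves \<open>t\<close> times the exponential series.\<close>
    have "?f (Suc k) = t *\<^sub>R ((t ^ k / fact k) *\<^sub>R c ^ k)" for k
      by (simp add: scaleR_conv_of_real field_simps del: of_nat_Suc)
    then have "(\<lambda>k. ?f (Suc k)) sums (t *\<^sub>R exp (t *\<^sub>R c))"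
      using sums_scaleR_right[OF e, of t] by simp
    then have "?f sums (t *\<^sub>R exp (t *\<^sub>R c))" by (subst (asm) sums_Suc_iff) simp
    then have "t *\<^sub>R exp (t *\<^sub>R c) = suminf ?f" by (rule sums_unique)
    then show ?thesis using that by (simp add: entry)
  qed
  then show "?E $$ (i, Suc i) \<noteq> 0" if "Suc i < n" for i
    using that assms by simp
qed

lemma mexp_0:
  fixes R :: "'a::{real_normed_field,banach} mat"
  assumes R: "R \<in> carrier_mat n n"
  shows "mexp 0 R = 1\<^sub>m n"
proof (rule mexp_eqI[OF R])
  fix i j assume "i < n" "j < n"
  have "(\<lambda>k. (0 ^ k / fact k) *\<^sub>R (R ^\<^sub>m k) $$ (i, j))
      = (\<lambda>k. if k = 0 then (1\<^sub>m n :: 'a mat) $$ (i, j) else 0)"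
    using R by (intro ext) (auto simp: power_0_left)
  then show "(\<lambda>k. (0 ^ k / fact k) *\<^sub>R (R ^\<^sub>m k) $$ (i, j)) sums ((1\<^sub>m n :: 'a mat) $$ (i, j))"
    using sums_single[of 0 "\<lambda>_. (1\<^sub>m n :: 'a mat) $$ (i, j)"] by simp
qed simp

section \<open>Real logarithms up to similarity\<close>

text \<open>Split a complex intertwining matrix as \<open>P = U + \<i> V\<close>. Since
  \<open>M\<close> and \<open>N\<close> are real, \<open>U\<close> and \<open>V\<close> intertwine
  them separately, and so does \<open>U + x V\<close> for every real \<open>x\<close>; it remains to
  find an \<open>x\<close> for which this is invertible.\<close>

lemma similar_mat_complex_imp_real:
  fixes M N :: "real mat"
  assumes M: "M \<in> carrier_mat n n"
    and sim: "similar_mat (map_mat complex_of_real M) (map_mat complex_of_real N)"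
  shows "similar_mat M N"
proof -
  let ?c = "map_mat complex_of_real"
  from sim obtain P P' where wit: "similar_mat_wit (?c M) (?c N) P P'"
    unfolding similar_mat_def by auto
  have cM: "?c M \<in> carrier_mat n n" using M by simp
  note w = similar_mat_witD2[OF cM wit]
  have N: "N \<in> carrier_mat n n" using w(5) by auto
  have P: "P \<in> carrier_mat n n" by fact
  have "?c M * P = P * ?c N * P' * P" using w(3) by simp
  also have "\<dots> = P * ?c N" using w by (simp add: assoc_mult_mat[of _ n n _ n _ n])
  finally have MP: "?c M * P = P * ?c N" .
  define U where "U = map_mat Re P"
  define V where "V = map_mat Im P"
  have U: "U \<in> carrier_mat n n" and V: "V \<in> carrier_mat n n" using P by (auto simp: U_def V_def)
  have MU: "(M * U) $$ (i, j) = (U * N) $$ (i, j)" and MV: "(M * V) $$ (i, j) = (V * N) $$ (i, j)"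
    if ij: "i < n" "j < n" for i j
  proof -
    have "(\<Sum>l<n. complex_of_real (M $$ (i, l)) * P $$ (l, j))
        = (\<Sum>l<n. P $$ (i, l) * complex_of_real (N $$ (l, j)))"
      using arg_cong[OF MP, of "\<lambda>X. X $$ (i, j)"] ij M N P
      by (simp add: mult_mat_index_sum[of _ n n _ n] del: index_mult_mat(1))
    from arg_cong[OF this, of Re] arg_cong[OF this, of Im]
    show "(M * U) $$ (i, j) = (U * N) $$ (i, j)" "(M * V) $$ (i, j) = (V * N) $$ (i, j)"
      using ij M N P U V
      by (simp_all add: mult_mat_index_sum[of _ n n _ n] U_def V_def del: index_mult_mat(1))
  qed
  \<comment> \<open>The real polynomial \<open>det (U + x V)\<close> does not vanish at \<open>x = \<i>\<close>, hence not at some real \<open>x\<close>.\<close>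
  define W where "W = mat n n (\<lambda>(i, j). [:U $$ (i, j), V $$ (i, j):])"
  have W: "W \<in> carrier_mat n n" by (simp add: W_def)
  interpret cp: map_poly_comm_ring_hom complex_of_real ..
  interpret ev_i: comm_ring_hom "\<lambda>p. poly (map_poly complex_of_real p) \<i>"
    by unfold_locales (auto simp: cp.hom_add cp.hom_mult)
  have "poly (map_poly complex_of_real (det W)) \<i> = det (map_mat (\<lambda>p. poly (map_poly complex_of_real p) \<i>) W)"
    by (rule ev_i.hom_det[symmetric])
  also have "map_mat (\<lambda>p. poly (map_poly complex_of_real p) \<i>) W = P"
    using P by (intro eq_matI) (auto simp: W_def U_def V_def complex_eq_iff of_real_hom.map_poly_pCons_hom)
  also have "det P \<noteq> 0"
    using det_mult[OF w(6,7)] w(1) by auto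
  finally have "det W \<noteq> 0" by auto
  then have "finite {x. poly (det W) x = 0}" by (rule poly_roots_finite)
  then obtain x where x: "poly (det W) x \<noteq> 0"
    using infinite_UNIV_char_0[where 'a = real] by (metis (mono_tags, lifting) UNIV_eq_I mem_Collect_eq)
  define X where "X = U + x \<cdot>\<^sub>m V"
  have X: "X \<in> carrier_mat n n" using U V by (simp add: X_def)
  have "map_mat (\<lambda>p. poly p x) W = X"
    using U V by (intro eq_matI) (auto simp: W_def X_def)
  moreover have "comm_ring_hom (\<lambda>p. poly p x)" by unfold_locales auto
  ultimately have "det X \<noteq> 0" using x comm_ring_hom.hom_det[of "\<lambda>p. poly p x" W] by simp
  from mat_inverse_exists[OF X this] obtain Y where
    Y: "Y \<in> carrier_mat n n" "X * Y = 1\<^sub>m n" "Y * X = 1\<^sub>m n" by blast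
  have "M * X = M * U + x \<cdot>\<^sub>m (M * V)"
    unfolding X_def using M U V
    by (simp add: mult_add_distrib_mat[of _ n n _ n] mult_smult_distrib[of _ n n _ n])
  also have "M * U = U * N" using MU M N U by (intro eq_matI) (auto simp del: index_mult_mat(1))
  also have "M * V = V * N" using MV M N V by (intro eq_matI) (auto simp del: index_mult_mat(1))
  also have "U * N + x \<cdot>\<^sub>m (V * N) = X * N"
    unfolding X_def using N U V
    by (simp add: add_mult_distrib_mat[of _ n n] mult_smult_assoc_mat[of _ n n _ n])
  finally have "X * N * Y = M * X * Y" by simp
  also have "\<dots> = M" using M X Y by (simp add: assoc_mult_mat[of _ n n _ n _ n])
  finally show ?thesis using M N X Y by (intro similar_matI[of _ _ X Y n]) auto
qed

text \<open>The real matrix of multiplication by \<open>c\<close> plus a nilpotent shift, where the columns of the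
  conjugating matrix come from the eigenvectors \<open>(1, \<mp>\<i>)\<close> of that multiplication.\<close>

lemma similar_realified_jordan_block:
  fixes c :: complex
  shows "similar_mat
    (map_mat complex_of_real (four_block_mat (jordan_block k (Re c)) (- Im c \<cdot>\<^sub>m 1\<^sub>m k)
       (Im c \<cdot>\<^sub>m 1\<^sub>m k) (jordan_block k (Re c))))
    (dirsum (jordan_block k c) (jordan_block k (cnj c)))"
    (is "similar_mat ?R ?D")
proof -
  define W where "W = four_block_mat (1\<^sub>m k) (1\<^sub>m k) (- \<i> \<cdot>\<^sub>m 1\<^sub>m k) (\<i> \<cdot>\<^sub>m 1\<^sub>m k)"
  define W' where "W' = four_block_mat ((1/2) \<cdot>\<^sub>m 1\<^sub>m k) ((\<i>/2) \<cdot>\<^sub>m 1\<^sub>m k)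
      ((1/2) \<cdot>\<^sub>m 1\<^sub>m k) ((- \<i>/2) \<cdot>\<^sub>m 1\<^sub>m k)"
  have R: "?R = four_block_mat (jordan_block k (of_real (Re c))) (- of_real (Im c) \<cdot>\<^sub>m 1\<^sub>m k)
      (of_real (Im c) \<cdot>\<^sub>m 1\<^sub>m k) (jordan_block k (of_real (Re c)))"
    by (rule eq_matI) auto
  have D: "?D = four_block_mat (jordan_block k c) (0\<^sub>m k k) (0\<^sub>m k k) (jordan_block k (cnj c))"
    by (rule dirsum_eq) auto
  have W: "W \<in> carrier_mat (k + k) (k + k)" and W': "W' \<in> carrier_mat (k + k) (k + k)"
    by (auto simp: W_def W'_def)
  have 1: "W * W' = 1\<^sub>m (k + k)"
    unfolding W_def W'_def
    by (subst mult_four_block_mat[of _ k k _ k _ k _ _ k _ k]) (auto intro!: eq_matI)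
  have 2: "W' * W = 1\<^sub>m (k + k)" by (rule mat_mult_left_right_inverse[OF W W' 1])
  \<comment> \<open>\<open>?E\<close> is the common value of \<open>?R * W\<close> and
    \<open>W * ?D\<close>; multiplying by the inverse \<open>W'\<close> on the right then gives the
    similarity.\<close>
  let ?E = "four_block_mat (jordan_block k c) (jordan_block k (cnj c))
      (- \<i> \<cdot>\<^sub>m jordan_block k c) (\<i> \<cdot>\<^sub>m jordan_block k (cnj c))"
  have "?R * W = ?E"
    unfolding R W_def
    by (subst mult_four_block_mat[of _ k k _ k _ k _ _ k _ k])
      (auto intro!: cong_four_block_mat eq_matI simp: complex_eq_iff
        mult_smult_distrib[of _ k k _ k] mult_smult_assoc_mat[of _ k k _ k])
  moreover have "W * ?D = ?E"
    unfolding D W_def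
    by (subst mult_four_block_mat[of _ k k _ k _ k _ _ k _ k])
      (auto intro!: cong_four_block_mat eq_matI simp: mult_smult_assoc_mat[of _ k k _ k])
  ultimately have "?R * W = W * ?D" by simp
  then have "W * ?D * W' = ?R * W * W'" by simp
  also have "\<dots> = ?R"
    using W W' 1 by (subst assoc_mult_mat[of _ "k + k" "k + k" _ "k + k" _ "k + k"]) auto
  finally show ?thesis using W W' 1 2 by (intro similar_matI[of _ _ W W' "k + k"]) auto
qed

text \<open>Take the realified block of a logarithm \<open>c\<close> of \<open>a\<close> divided by
  \<open>T\<close>: its complex blocks belong to \<open>c\<close> and \<open>cnj c\<close>, and
  their exponentials to \<open>a\<close> and \<open>cnj a\<close>. For negative real
  \<open>a\<close> this yields two equal blocks, which is why even multiplicity suffices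
  there.\<close>

lemma mexp_conjugate_pair:
  fixes a :: complex
  assumes "T \<noteq> 0" "a \<noteq> 0"
  shows "\<exists>R. R \<in> carrier_mat (k + k) (k + k) \<and>
    similar_mat (map_mat complex_of_real (mexp T R)) (dirsum (jordan_block k a) (jordan_block k (cnj a)))"
proof -
  define c where "c = Ln a / of_real T"
  have a: "exp (T *\<^sub>R c) = a" using assms by (simp add: c_def scaleR_conv_of_real)
  have a': "exp (T *\<^sub>R cnj c) = cnj a"
    unfolding a[symmetric] exp_cnj by (simp add: scaleR_conv_of_real)
  let ?R = "four_block_mat (jordan_block k (Re c)) (- Im c \<cdot>\<^sub>m 1\<^sub>m k) (Im c \<cdot>\<^sub>m 1\<^sub>m k) (jordan_block k (Re c))"
  have R: "?R \<in> carrier_mat (k + k) (k + k)" by auto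
  have "similar_mat (map_mat complex_of_real (mexp T ?R))
      (mexp T (dirsum (jordan_block k c) (jordan_block k (cnj c))))"
    unfolding map_mat_of_real_mexp[OF R]
    by (rule similar_mat_mexp[OF similar_realified_jordan_block])
  also have "mexp T (dirsum (jordan_block k c) (jordan_block k (cnj c)))
      = dirsum (mexp T (jordan_block k c)) (mexp T (jordan_block k (cnj c)))"
    by (rule mexp_dirsum) auto
  also have "similar_mat \<dots> (dirsum (jordan_block k a) (jordan_block k (cnj a)))"
    using mexp_jordan_block[OF assms(1), of k c] mexp_jordan_block[OF assms(1), of k "cnj c"]
    unfolding a a' by (rule similar_mat_dirsum)
  finally show ?thesis using R by blast
qed

lemma mexp_positive_block:
  fixes a :: complex
  assumes "T \<noteq> 0" "a \<in> \<real>" "Re a > 0"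
  shows "\<exists>R. R \<in> carrier_mat k k \<and> similar_mat (map_mat complex_of_real (mexp T R)) (jordan_block k a)"
proof -
  define c where "c = ln (Re a) / T"
  have "T *\<^sub>R complex_of_real c = of_real (ln (Re a))"
    using assms(1) by (simp add: c_def scaleR_conv_of_real)
  then have a: "exp (T *\<^sub>R complex_of_real c) = a"
    using assms(2,3) by (simp add: exp_of_real)
  have "map_mat complex_of_real (jordan_block k c) = jordan_block k (of_real c)"
    by (rule eq_matI) auto
  then have "similar_mat (map_mat complex_of_real (mexp T (jordan_block k c))) (jordan_block k a)"
    using mexp_jordan_block[OF assms(1), of k "complex_of_real c"]
    by (simp add: map_mat_of_real_mexp[OF jordan_block_carrier] a)
  then show ?thesis by (intro exI[of _ "jordan_block k c"]) auto
qed

text \<open>Strong induction on the number of blocks. A block with positive eigenvalue is split off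
  alone; any other block is split off together with a conjugate partner. The remaining list inherits
  the symmetry and parity hypotheses.\<close>

lemma real_log_jordan_matrix:
  fixes bs :: "(nat \<times> complex) list"
  assumes T: "T \<noteq> 0"
    and "\<And>k a. (k, a) \<in> set bs \<Longrightarrow> a \<noteq> 0"
    and "\<And>k a. count_list bs (k, cnj a) = count_list bs (k, a)"
    and "\<And>k a. a \<in> \<real> \<Longrightarrow> Re a < 0 \<Longrightarrow> even (count_list bs (k, a))"
  shows "\<exists>R. R \<in> carrier_mat (sum_list (map fst bs)) (sum_list (map fst bs)) \<and>
    similar_mat (map_mat complex_of_real (mexp T R)) (jordan_matrix bs)"
  using assms(2-)
proof (induction "length bs" arbitrary: bs rule: less_induct)
  case less
  let ?c = "map_mat complex_of_real"
  show ?case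
  proof (cases bs)
    case Nil
    have "?c (mexp T (0\<^sub>m 0 0)) = 0\<^sub>m 0 0" by (rule eq_matI) auto
    then have "similar_mat (?c (mexp T (0\<^sub>m 0 0))) (jordan_matrix [])"
      using similar_mat_refl[of "0\<^sub>m 0 0 :: complex mat" 0] by (simp add: jordan_matrix_Nil)
    with Nil show ?thesis by (intro exI[of _ "0\<^sub>m 0 0"]) auto
  next
    case (Cons b xs)
    obtain k a where b: "b = (k, a)" by force
    have a0: "a \<noteq> 0" using less.prems(1) Cons b by auto
    show ?thesis
    proof (cases "a \<in> \<real> \<and> Re a > 0")
      case True
      have cnj_a: "cnj a = a" using True by (simp add: Reals_cnj_iff)
      have cnt: "count_list bs (l, e) = count_list xs (l, e) + (if (l, e) = (k, a) then 1 else 0)" for l e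
        by (auto simp: Cons b)
      have "\<exists>R. R \<in> carrier_mat (sum_list (map fst xs)) (sum_list (map fst xs)) \<and>
          similar_mat (?c (mexp T R)) (jordan_matrix xs)"
      proof (rule less.hyps)
        show "length xs < length bs" by (simp add: Cons)
        show "e \<noteq> 0" if "(l, e) \<in> set xs" for l e using less.prems(1) that by (auto simp: Cons)
        show "count_list xs (l, cnj e) = count_list xs (l, e)" for l e
        proof -
          have "(l, cnj e) = (k, a) \<longleftrightarrow> (l, e) = (k, a)"
            using cnj_a by (metis complex_cnj_cnj prod.inject)
          then show ?thesis using less.prems(2)[of l e] unfolding cnt by simp
        qed
        show "even (count_list xs (l, e))" if "e \<in> \<real>" "Re e < 0" for l e
          using less.prems(3)[OF that, of l] that True unfolding cnt by (auto split: if_splits)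
      qed
      then obtain R2 where R2: "R2 \<in> carrier_mat (sum_list (map fst xs)) (sum_list (map fst xs))"
        "similar_mat (?c (mexp T R2)) (jordan_matrix xs)" by auto
      obtain R1 where R1: "R1 \<in> carrier_mat k k" "similar_mat (?c (mexp T R1)) (jordan_block k a)"
        using mexp_positive_block[OF T] True by blast
      have "?c (mexp T (dirsum R1 R2)) = dirsum (?c (mexp T R1)) (?c (mexp T R2))"
        using R1 R2 by (subst mexp_dirsum[OF R1(1) R2(1)], subst map_mat_dirsum[of _ _ k]) auto
      also have "similar_mat \<dots> (jordan_matrix bs)"
        unfolding Cons b jordan_matrix_Cons_dirsum by (rule similar_mat_dirsum[OF R1(2) R2(2)])
      finally show ?thesis using R1 R2 by (intro exI[of _ "dirsum R1 R2"]) (auto simp: Cons b)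
    next
      case False
      \<comment> \<open>The partner exists by parity when \<open>a\<close> is real, hence negative,
        and by conjugation symmetry when it is not real.\<close>
      have "(k, cnj a) \<in> set xs"
      proof (cases "cnj a = a")
        case True
        then have "a \<in> \<real>" by (simp add: Reals_cnj_iff)
        moreover from this have "Re a < 0"
          using False a0 by (auto simp: complex_eq_iff complex_is_Real_iff)
        ultimately have "even (count_list bs (k, a))" using less.prems(3) by blast
        then have "count_list xs (k, a) \<noteq> 0" by (auto simp: Cons b odd_pos)
        then show ?thesis using True by (metis count_list_0_iff)
      next
        case False
        then have "count_list xs (k, cnj a) = Suc (count_list xs (k, a))"
          using less.prems(2)[of k a] by (auto simp: Cons b)
        then show ?thesis by (metis count_list_0_iff nat.distinct(1))
      qed
      then obtain us vs where xs: "xs = us @ (k, cnj a) # vs" by (meson split_list)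
      let ?ys = "us @ vs"
      \<comment> \<open>Two separate indicators: for real \<open>a\<close> both hit the same block
        and its count drops by two, which preserves parity.\<close>
      have cnt: "count_list bs (l, e) = count_list ?ys (l, e)
          + ((if (l, e) = (k, a) then 1 else 0) + (if (l, e) = (k, cnj a) then 1 else 0))" for l e
        by (auto simp: Cons b xs)
      have "\<exists>R. R \<in> carrier_mat (sum_list (map fst ?ys)) (sum_list (map fst ?ys)) \<and>
          similar_mat (?c (mexp T R)) (jordan_matrix ?ys)"
      proof (rule less.hyps)
        show "length ?ys < length bs" by (simp add: Cons xs)
        show "e \<noteq> 0" if "(l, e) \<in> set ?ys" for l e
          using less.prems(1)[of l e] that by (auto simp: Cons xs)
        show "count_list ?ys (l, cnj e) = count_list ?ys (l, e)" for l e
        proof -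
          have "(l, cnj e) = (k, a) \<longleftrightarrow> (l, e) = (k, cnj a)" "(l, cnj e) = (k, cnj a) \<longleftrightarrow> (l, e) = (k, a)"
            by auto
          then show ?thesis using less.prems(2)[of l e] unfolding cnt by (simp split: if_splits)
        qed
        show "even (count_list ?ys (l, e))" if e: "e \<in> \<real>" "Re e < 0" for l e
        proof -
          have "(l, e) = (k, cnj a) \<longleftrightarrow> (l, e) = (k, a)"
            using e(1) by (auto simp: Reals_cnj_iff)
          then show ?thesis using less.prems(3)[OF e, of l] unfolding cnt by (auto split: if_splits)
        qed
      qed
      then obtain R2 where R2: "R2 \<in> carrier_mat (sum_list (map fst ?ys)) (sum_list (map fst ?ys))"
        "similar_mat (?c (mexp T R2)) (jordan_matrix ?ys)" by auto
      obtain R1 where R1: "R1 \<in> carrier_mat (k + k) (k + k)"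
        "similar_mat (?c (mexp T R1)) (dirsum (jordan_block k a) (jordan_block k (cnj a)))"
        using mexp_conjugate_pair[OF T a0] by blast
      have "?c (mexp T (dirsum R1 R2)) = dirsum (?c (mexp T R1)) (?c (mexp T R2))"
        using R1 R2 by (subst mexp_dirsum[OF R1(1) R2(1)], subst map_mat_dirsum[of _ _ "k + k"]) auto
      also have "similar_mat \<dots> (dirsum (dirsum (jordan_block k a) (jordan_block k (cnj a))) (jordan_matrix ?ys))"
        by (rule similar_mat_dirsum[OF R1(2) R2(2)])
      also have "\<dots> = jordan_matrix ((k, a) # (k, cnj a) # ?ys)"
        by (simp only: jordan_matrix_Cons_dirsum dirsum_assoc)
      also have "similar_mat \<dots> (jordan_matrix bs)"
        by (rule similar_jordan_matrix_perm) (simp add: Cons b xs)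
      finally show ?thesis
        using dirsum_carrier_mat[OF R1(1) R2(1)]
        by (intro exI[of _ "dirsum R1 R2"]) (simp add: Cons b xs add_ac)
    qed
  qed
qed

section \<open>The Jordan form of a real monodromy matrix\<close>

lemma map_mat_cnj_jordan_matrix:
  "map_mat cnj (jordan_matrix bs) = jordan_matrix (map (map_prod id cnj) bs)"
proof (induction bs)
  case Nil
  then show ?case by (intro eq_matI) (auto simp: jordan_matrix_Nil)
next
  case (Cons b bs)
  obtain k a where b: "b = (k, a)" by force
  have "map_mat cnj (jordan_block k a) = jordan_block k (cnj a)" by (rule eq_matI) auto
  then show ?case
    by (simp add: b jordan_matrix_Cons_dirsum Cons
        map_mat_dirsum[OF _ jordan_block_carrier jordan_matrix_carrier])
qed

text \<open>Conjugating all entries of a similarity to the Jordan form fixes the real matrix and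
  conjugates the eigenvalues, so it produces a second Jordan form. The number of blocks of each size
  and eigenvalue is determined by the matrix.\<close>

lemma jordan_nf_count_cnj:
  fixes M :: "real mat"
  assumes jnf: "jordan_nf (map_mat complex_of_real M) bs"
  shows "count_list bs (k, cnj a) = count_list bs (k, a)"
proof (cases "k = 0")
  \<comment> \<open>Blocks of size zero are excluded from a Jordan form, so both counts are
    zero.\<close>
  case True
  then have "(k, e) \<notin> set bs" for e using jnf unfolding jordan_nf_def by force
  then show ?thesis by simp
next
  case False
  let ?M = "map_mat complex_of_real M" and ?bs = "map (map_prod id cnj) bs"
  interpret cnj: comm_ring_hom cnj by unfold_locales auto
  from jnf obtain P Q where wit: "similar_mat_wit ?M (jordan_matrix bs) P Q"
    unfolding jordan_nf_def similar_mat_def by auto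
  define n where "n = dim_row ?M"
  note w = similar_mat_witD[OF n_def wit]
  have cM: "map_mat cnj ?M = ?M" by (rule eq_matI) auto
  have "similar_mat ?M (jordan_matrix ?bs)"
  proof (rule similar_matI)
    show "{?M, jordan_matrix ?bs, map_mat cnj P, map_mat cnj Q} \<subseteq> carrier_mat n n"
      unfolding map_mat_cnj_jordan_matrix[symmetric] using w by auto
    show "map_mat cnj P * map_mat cnj Q = 1\<^sub>m n"
      using cnj.mat_hom_mult[OF w(6,7)] w(1) by (simp add: cnj.mat_hom_one)
    show "map_mat cnj Q * map_mat cnj P = 1\<^sub>m n"
      using cnj.mat_hom_mult[OF w(7,6)] w(2) by (simp add: cnj.mat_hom_one)
    have "?M = map_mat cnj (P * jordan_matrix bs * Q)" using w(3) cM by simp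
    also have "\<dots> = map_mat cnj P * map_mat cnj (jordan_matrix bs) * map_mat cnj Q"
      using w(5-7) by (simp add: cnj.mat_hom_mult[of _ n n _ n])
    finally show "?M = map_mat cnj P * jordan_matrix ?bs * map_mat cnj Q"
      unfolding map_mat_cnj_jordan_matrix .
  qed
  then have jnf': "jordan_nf ?M ?bs" using jnf unfolding jordan_nf_def by force
  have "count_list bs (k, cnj a) = count_list ?bs (k, cnj a)"
    using compute_nr_of_jordan_blocks[OF jnf False, of "cnj a"]
      compute_nr_of_jordan_blocks[OF jnf' False, of "cnj a"]
    by (simp add: count_list_eq_length_filter)
  also have "\<dots> = count_list bs (k, a)"
    by (induction bs) auto
  finally show ?thesis .
qed

text \<open>A nonempty block for the eigenvalue zero makes zero a root of the characteristic
  polynomial, which gives a nonzero kernel vector.\<close>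

lemma jordan_nf_nonzero:
  fixes M :: "complex mat"
  assumes M: "M \<in> carrier_mat n n" and det: "det M \<noteq> 0"
    and jnf: "jordan_nf M bs" and mem: "(k, a) \<in> set bs"
  shows "a \<noteq> 0"
proof
  assume a: "a = 0"
  have "k \<noteq> 0" using jnf mem unfolding jordan_nf_def by force
  moreover have "k \<le> Polynomial.order a (char_poly M)" by (rule jordan_nf_block_size_order_bound[OF jnf mem])
  ultimately have "poly (char_poly M) 0 = 0" using a by (metis gr_zeroI le_zero_eq order_root)
  then have "eigenvalue M 0" using eigenvalue_root_char_poly[OF M] by simp
  then obtain v where v: "v \<in> carrier_vec n" "v \<noteq> 0\<^sub>v n" "M *\<^sub>v v = 0 \<cdot>\<^sub>v v"
    using M unfolding eigenvalue_def eigenvector_def by auto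
  moreover have "0 \<cdot>\<^sub>v v = 0\<^sub>v n" using v(1) by (intro eq_vecI) auto
  ultimately have "v \<in> carrier_vec n" "v \<noteq> 0\<^sub>v n" "M *\<^sub>v v = 0\<^sub>v n" by auto
  with det det_0_iff_vec_prod_zero[OF M] show False by blast
qed

lemma complex_jordan_nf_exists:
  fixes M :: "complex mat"
  assumes "M \<in> carrier_mat n n"
  shows "\<exists>bs. jordan_nf M bs"
  using char_poly_factorized[OF assms] jordan_nf_exists[OF assms] by blast

lemma similar_mat_dim_eq:
  assumes "similar_mat A B" "A \<in> carrier_mat n n" "B \<in> carrier_mat m m"
  shows "n = m"
  using similar_matD[OF assms(1)] assms(2,3) by auto

text \<open>The Jordan form \<open>bs\<close> is divided into \<open>ds\<close>, one copy of each
  negative block of odd multiplicity, and the rest \<open>es\<close>. Negative blocks have even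
  multiplicity in \<open>es\<close>, and negating \<open>ds\<close> makes its eigenvalues positive,
  so both lists have real logarithms.\<close>

lemma similar_mexp_dirsum_minus_mexp:
  fixes M :: "real mat"
  assumes M: "M \<in> carrier_mat n n" and det: "det M \<noteq> 0" and T: "T \<noteq> 0"
  shows "\<exists>R1 R2. aindex_mat M \<le> n \<and>
    R1 \<in> carrier_mat (n - aindex_mat M) (n - aindex_mat M) \<and>
    R2 \<in> carrier_mat (aindex_mat M) (aindex_mat M) \<and>
    similar_mat M (dirsum (mexp T R1) (- mexp T R2))"
proof -
  let ?c = "map_mat complex_of_real"
  \<comment> \<open>This is the very choice made in \<open>aindex_mat\<close>, so the sizes in
    \<open>ds\<close> add up to \<open>aindex_mat M\<close>.\<close>
  define bs where "bs = (SOME bs. jordan_nf (?c M) bs)"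
  have cM: "?c M \<in> carrier_mat n n" using M by simp
  have jnf: "jordan_nf (?c M) bs"
    unfolding bs_def by (rule someI_ex[OF complex_jordan_nf_exists[OF cM]])
  have detc: "det (?c M) \<noteq> 0" using det by (simp add: of_real_hom.hom_det)
  define D where "D = {b \<in> set bs. snd b \<in> \<real> \<and> Re (snd b) < 0 \<and> odd (count_list bs b)}"
  have "finite D" unfolding D_def by simp
  then obtain ds where ds: "set ds = D" "distinct ds" using finite_distinct_list by blast
  define d where "d = aindex_mat M"
  have "d = sum fst D"
    unfolding d_def aindex_mat_def bs_def[symmetric] D_def by (simp add: Let_def)
  also have "\<dots> = sum_list (map fst ds)" using ds by (simp add: sum_list_distinct_conv_sum_set)
  finally have d: "d = sum_list (map fst ds)" .
  have dsD: "a \<in> \<real>" "Re a < 0" "odd (count_list bs (k, a))" if "(k, a) \<in> set ds" for k a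
    using that ds(1) unfolding D_def by auto
  have cnt_ds: "count_list ds b = (if b \<in> D then 1 else 0)" for b
    using ds by (simp add: count_list_eq_length_filter distinct_length_filter)
  \<comment> \<open>An odd multiplicity is at least one, so a copy of each block of \<open>D\<close>
    can be removed from \<open>bs\<close>.\<close>
  have "mset ds \<subseteq># mset bs"
    by (rule mset_subset_eqI) (auto simp: cnt_ds count_mset D_def intro: Suc_leI odd_pos)
  moreover obtain es where es: "mset es = mset bs - mset ds" using ex_mset by blast
  ultimately have perm: "mset bs = mset (es @ ds)" by simp
  have cnt: "count_list bs b = count_list es b + (if b \<in> D then 1 else 0)" for b
    using arg_cong[OF perm, of "\<lambda>m. count m b"] by (simp add: count_mset cnt_ds)
  have D_cnj: "(k, cnj a) \<in> D \<longleftrightarrow> (k, a) \<in> D" for k a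
  proof -
    have "cnj a = a" if "a \<in> \<real> \<or> cnj a \<in> \<real>" using that by (metis Reals_cnj_iff complex_cnj_cnj)
    then show ?thesis unfolding D_def by fastforce
  qed
  have "\<exists>R. R \<in> carrier_mat (sum_list (map fst es)) (sum_list (map fst es)) \<and>
      similar_mat (?c (mexp T R)) (jordan_matrix es)"
  proof (rule real_log_jordan_matrix[OF T])
    have sub: "set es \<subseteq> set bs" using perm by (metis Un_iff set_append set_mset_mset subsetI)
    show "a \<noteq> 0" if "(k, a) \<in> set es" for k a
      using jordan_nf_nonzero[OF cM detc jnf] that sub by blast
    show "count_list es (k, cnj a) = count_list es (k, a)" for k a
      using jordan_nf_count_cnj[OF jnf, of k a] D_cnj[of k a] unfolding cnt by simp
    show "even (count_list es (k, a))" if "a \<in> \<real>" "Re a < 0" for k a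
    proof (cases "(k, a) \<in> D")
      case True
      then have "odd (count_list bs (k, a))" unfolding D_def by simp
      then show ?thesis using True unfolding cnt by simp
    next
      case False
      then have "even (count_list bs (k, a))"
        using that unfolding D_def by (auto simp: count_list_0_iff)
      then show ?thesis using False unfolding cnt by simp
    qed
  qed
  then obtain R1 where R1: "R1 \<in> carrier_mat (sum_list (map fst es)) (sum_list (map fst es))"
    "similar_mat (?c (mexp T R1)) (jordan_matrix es)" by auto
  let ?ds = "map (\<lambda>(k, a). (k, - 1 * a)) ds"
  have fst_ds: "map fst ?ds = map fst ds" by auto
  have pos: "a \<in> \<real> \<and> Re a > 0" if "(k, a) \<in> set ?ds" for k a
    using that dsD by auto
  have "\<exists>R. R \<in> carrier_mat (sum_list (map fst ?ds)) (sum_list (map fst ?ds)) \<and>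
      similar_mat (?c (mexp T R)) (jordan_matrix ?ds)"
  proof (rule real_log_jordan_matrix[OF T])
    show "a \<noteq> 0" if "(k, a) \<in> set ?ds" for k a using pos[OF that] by auto
    show "count_list ?ds (k, cnj a) = count_list ?ds (k, a)" for k a
    proof (cases "cnj a = a")
      case False
      then have "(k, a) \<notin> set ?ds" "(k, cnj a) \<notin> set ?ds"
        using pos by (metis Reals_cnj_iff complex_cnj_cnj)+
      then show ?thesis by (metis count_list_0_iff)
    qed simp
    show "even (count_list ?ds (k, a))" if "a \<in> \<real>" "Re a < 0" for k a
    proof -
      have "(k, a) \<notin> set ?ds" using pos[of k a] that(2) by linarith
      then show ?thesis by (metis count_list_0_iff even_zero)
    qed
  qed
  then obtain R2 where R2: "R2 \<in> carrier_mat d d"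
    "similar_mat (?c (mexp T R2)) (jordan_matrix ?ds)"
    unfolding fst_ds d[symmetric] by auto
  \<comment> \<open>A second sign change takes \<open>?ds\<close> back to \<open>ds\<close> and
    turns the exponential into its negative.\<close>
  have "similar_mat (- 1 \<cdot>\<^sub>m ?c (mexp T R2)) (- 1 \<cdot>\<^sub>m jordan_matrix ?ds)"
    by (rule similar_mat_smult[OF R2(2)])
  also have "similar_mat (- 1 \<cdot>\<^sub>m jordan_matrix ?ds) (jordan_matrix (map (\<lambda>(k, a). (k, - 1 * a)) ?ds))"
    by (rule similar_mat_jordan_matrix_smult) simp
  also have "map (\<lambda>(k, a). (k, - 1 * a)) ?ds = ds"
    by (rule nth_equalityI) (auto split: prod.splits)
  also have "- 1 \<cdot>\<^sub>m ?c (mexp T R2) = ?c (- mexp T R2)" by (rule eq_matI) auto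
  finally have R2': "similar_mat (?c (- mexp T R2)) (jordan_matrix ds)" .
  let ?N = "dirsum (mexp T R1) (- mexp T R2)"
  have mR2: "- mexp T R2 \<in> carrier_mat d d" using R2(1) by auto
  have "similar_mat (?c M) (jordan_matrix bs)" using jnf unfolding jordan_nf_def by simp
  also have "similar_mat (jordan_matrix bs) (jordan_matrix (es @ ds))"
    by (rule similar_jordan_matrix_perm[OF perm])
  also have "jordan_matrix (es @ ds) = dirsum (jordan_matrix es) (jordan_matrix ds)"
    by (rule jordan_matrix_append)
  also have "similar_mat \<dots> (dirsum (?c (mexp T R1)) (?c (- mexp T R2)))"
    by (intro similar_mat_dirsum similar_mat_sym[OF R1(2)] similar_mat_sym[OF R2'])
  also have "\<dots> = ?c ?N"
    by (rule map_mat_dirsum[symmetric, OF _ mexp_carrier_mat[OF R1(1)] mR2]) simp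
  finally have "similar_mat (?c M) (?c ?N)" .
  then have sim: "similar_mat M ?N" by (rule similar_mat_complex_imp_real[OF M])
  \<comment> \<open>Similar matrices have equal size, which fixes the size of \<open>R1\<close> as
    \<open>n - d\<close>.\<close>
  have "n = sum_list (map fst es) + d"
    by (rule similar_mat_dim_eq[OF sim M]) (use R1 mR2 in auto)
  then have "d \<le> n" "R1 \<in> carrier_mat (n - d) (n - d)" using R1(1) by auto
  with R2(1) sim show ?thesis unfolding d_def by blast
qed

section \<open>Linear differential equations\<close>

text \<open>The primitive on the whole line normalised at zero, fixed by its properties instead of
  an integral formula, so that positive and negative times are treated alike.\<close>

definition antideriv :: "(real \<Rightarrow> real) \<Rightarrow> real \<Rightarrow> real" where
  "antideriv f = (SOME F. F 0 = 0 \<and> (\<forall>t. (F has_real_derivative f t) (at t)))"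

lemma antideriv:
  assumes "continuous_on UNIV f"
  shows "antideriv f 0 = 0" "(antideriv f has_real_derivative f t) (at t)"
proof -
  have "isCont f x" for x using assms by (simp add: continuous_on_eq_continuous_at)
  then obtain F where F: "\<And>x. (F has_vector_derivative f x) (at x)"
    using einterval_antiderivative[of "-\<infinity>" \<infinity> f] by auto
  have "\<exists>F. F 0 = 0 \<and> (\<forall>t. (F has_real_derivative f t) (at t))"
  proof (intro exI[of _ "\<lambda>t. F t - F 0"] conjI allI)
    show "((\<lambda>t. F t - F 0) has_real_derivative f t) (at t)" for t
      using F[of t] by (auto intro!: derivative_eq_intros simp: has_real_derivative_iff_has_vector_derivative)
  qed simp
  from someI_ex[OF this]
  show "antideriv f 0 = 0" "(antideriv f has_real_derivative f t) (at t)"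
    unfolding antideriv_def by blast+
qed

text \<open>The difference between the bound and \<open>F\<close> vanishes at zero and has
  nonnegative derivative on the interval up to \<open>t\<close>.\<close>

lemma primitive_le_power:
  fixes F f :: "real \<Rightarrow> real"
  assumes "F 0 = 0" "\<And>s. (F has_real_derivative f s) (at s)" "0 \<le> t"
    and le: "\<And>s. 0 \<le> s \<Longrightarrow> s \<le> t \<Longrightarrow> f s \<le> C * s ^ k"
  shows "F t \<le> C * t ^ Suc k / real (Suc k)"
proof -
  have "((\<lambda>s. C * s ^ Suc k / real (Suc k) - F s) has_real_derivative (C * s ^ k - f s)) (at s)" for s
    by (rule derivative_eq_intros assms(2) refl | simp del: of_nat_Suc)+
  then have "C * 0 ^ Suc k / real (Suc k) - F 0 \<le> C * t ^ Suc k / real (Suc k) - F t"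
    by (intro DERIV_nonneg_imp_nondecreasing[OF assms(3)]) (use le in fastforce)
  with assms(1) show ?thesis by simp
qed

text \<open>The one-sided estimate is applied to \<open>F\<close> and \<open>- F\<close>, and for
  negative \<open>t\<close> to their reflections at zero.\<close>

lemma abs_primitive_le_power:
  fixes F f :: "real \<Rightarrow> real"
  assumes F0: "F 0 = 0" and F: "\<And>s. (F has_real_derivative f s) (at s)"
    and le: "\<And>s. \<bar>s\<bar> \<le> r \<Longrightarrow> \<bar>f s\<bar> \<le> C * \<bar>s\<bar> ^ k" and t: "\<bar>t\<bar> \<le> r"
  shows "\<bar>F t\<bar> \<le> C * \<bar>t\<bar> ^ Suc k / real (Suc k)"
proof -
  have mF: "((\<lambda>s. - F s) has_real_derivative - f s) (at s)" for s
    by (rule DERIV_minus[OF F])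
  have Fm: "((\<lambda>s. F (- s)) has_real_derivative - f (- s)) (at s)" for s
    using DERIV_chain2[OF F, of "\<lambda>s. - s" "-1" s UNIV] by (simp add: DERIV_minus[OF DERIV_ident])
  have mFm: "((\<lambda>s. - F (- s)) has_real_derivative f (- s)) (at s)" for s
    using DERIV_minus[OF Fm, of s] by simp
  have bnd: "f s \<le> C * \<bar>s\<bar> ^ k" "- f s \<le> C * \<bar>s\<bar> ^ k" if "\<bar>s\<bar> \<le> r" for s
    using le[OF that] by linarith+
  show ?thesis
  proof (cases "t \<ge> 0")
    case True
    have "F t \<le> C * t ^ Suc k / real (Suc k)"
    proof (rule primitive_le_power[OF F0 F True])
      show "f s \<le> C * s ^ k" if "0 \<le> s" "s \<le> t" for s using bnd(1)[of s] t that by simp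
    qed
    moreover have "- F t \<le> C * t ^ Suc k / real (Suc k)"
    proof (rule primitive_le_power[OF _ mF True])
      show "- f s \<le> C * s ^ k" if "0 \<le> s" "s \<le> t" for s using bnd(2)[of s] t that by simp
    qed (simp add: F0)
    ultimately show ?thesis using True by simp
  next
    case False
    then have nt: "0 \<le> - t" by simp
    have "F (- (- t)) \<le> C * (- t) ^ Suc k / real (Suc k)"
    proof (rule primitive_le_power[OF _ Fm nt])
      show "- f (- s) \<le> C * s ^ k" if "0 \<le> s" "s \<le> - t" for s using bnd(2)[of "- s"] t that by simp
    qed (simp add: F0)
    moreover have "- F (- (- t)) \<le> C * (- t) ^ Suc k / real (Suc k)"
    proof (rule primitive_le_power[OF _ mFm nt])
      show "f (- s) \<le> C * s ^ k" if "0 \<le> s" "s \<le> - t" for s using bnd(1)[of "- s"] t that by simp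
    qed (simp add: F0)
    ultimately show ?thesis using False by (simp add: abs_if del: power_Suc of_nat_Suc)
  qed
qed

text \<open>Component \<open>i\<close> of the \<open>k\<close>-th term of the Peano-Baker series:
  the constant start vector \<open>v\<close> after \<open>k\<close> rounds of multiplying by
  \<open>a\<close> and integrating from zero.\<close>

primrec peano_baker ::
  "nat \<Rightarrow> (nat \<Rightarrow> nat \<Rightarrow> real \<Rightarrow> real) \<Rightarrow> (nat \<Rightarrow> real) \<Rightarrow> nat \<Rightarrow> nat \<Rightarrow> real \<Rightarrow> real" where
  "peano_baker n a v 0 i = (\<lambda>_. v i)"
| "peano_baker n a v (Suc k) i = antideriv (\<lambda>s. \<Sum>l<n. a i l s * peano_baker n a v k l s)"

text \<open>The sum of the Peano-Baker terms is the solution. On a bounded interval the terms are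
  dominated by an exponential series, which permits differentiation term by term.\<close>

lemma linear_ode_exists:
  fixes a :: "nat \<Rightarrow> nat \<Rightarrow> real \<Rightarrow> real" and v :: "nat \<Rightarrow> real"
  assumes cont: "\<And>i j. i < n \<Longrightarrow> j < n \<Longrightarrow> continuous_on UNIV (a i j)"
  shows "\<exists>x. \<forall>i<n. x i 0 = v i \<and>
    (\<forall>t. (x i has_real_derivative (\<Sum>l<n. a i l t * x l t)) (at t))"
proof -
  define \<phi> where "\<phi> = peano_baker n a v"
  define g where "g k i s = (\<Sum>l<n. a i l s * \<phi> k l s)" for k i s
  have \<phi>_Suc: "\<phi> (Suc k) i = antideriv (g k i)" for k i
    by (simp add: \<phi>_def g_def[abs_def])
  have \<phi>_cont: "\<forall>i<n. continuous_on UNIV (\<phi> k i)" for k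
  proof (induction k)
    case 0
    then show ?case by (simp add: \<phi>_def)
  next
    case (Suc k)
    have "continuous_on UNIV (g k i)" if "i < n" for i
      unfolding g_def using Suc cont that by (intro continuous_intros) auto
    then show ?case
      unfolding \<phi>_Suc by (meson DERIV_isCont antideriv(2) continuous_at_imp_continuous_on)
  qed
  have g_cont: "continuous_on UNIV (g k i)" if "i < n" for k i
    unfolding g_def using \<phi>_cont cont that by (intro continuous_intros) auto
  have \<phi>_0: "\<phi> (Suc k) i 0 = 0" and \<phi>_deriv: "(\<phi> (Suc k) i has_real_derivative g k i t) (at t)"
    if "i < n" for k i t
    using antideriv[OF g_cont[OF that]] unfolding \<phi>_Suc by auto
  define x where "x i t = (\<Sum>k. \<phi> k i t)" for i t
  have \<phi>_at_0: "\<phi> k i 0 = (if k = 0 then v i else 0)" if "i < n" for k i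
    using \<phi>_0[OF that] by (cases k) (auto simp: \<phi>_def)
  have "x i 0 = v i" if "i < n" for i
  proof -
    have "(\<lambda>k. if k = 0 then v i else 0) sums v i" using sums_single[of 0 "\<lambda>_. v i"] by simp
    then show ?thesis unfolding x_def using \<phi>_at_0[OF that] by (simp add: sums_iff)
  qed
  moreover have "(x i has_real_derivative (\<Sum>l<n. a i l t * x l t)) (at t)" if i: "i < n" for i t
  proof -
    \<comment> \<open>The added 1 puts \<open>t\<close> into the interior of the compact interval,
      as needed for a two-sided derivative at \<open>t\<close>.\<close>
    define r where "r = \<bar>t\<bar> + 1"
    have r: "r > 0" "t \<in> {-r..r}" "t \<in> interior {-r..r}" unfolding r_def by auto
    have "\<exists>B. \<forall>s\<in>{-r..r}. \<bar>a i l s\<bar> \<le> B" if "i < n" "l < n" for i l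
    proof -
      have "compact (a i l ` {-r..r})"
        by (intro compact_continuous_image continuous_on_subset[OF cont[OF that]]) auto
      then have "bounded (a i l ` {-r..r})" by (rule compact_imp_bounded)
      then show ?thesis by (auto simp: bounded_iff)
    qed
    then obtain b where b: "\<And>i l s. i < n \<Longrightarrow> l < n \<Longrightarrow> s \<in> {-r..r} \<Longrightarrow> \<bar>a i l s\<bar> \<le> b i l"
      by metis
    \<comment> \<open>The sum of all entry bounds serves every entry at once. In \<open>c\<close>
      the factor \<open>n\<close> comes from the sum over \<open>l\<close>.\<close>
    define B where "B = (\<Sum>i<n. \<Sum>l<n. \<bar>b i l\<bar>)"
    have aB: "\<bar>a i l s\<bar> \<le> B" if "i < n" "l < n" "\<bar>s\<bar> \<le> r" for i l s
    proof -
      have "\<bar>a i l s\<bar> \<le> \<bar>b i l\<bar>" using b[of i l s] that by fastforce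
      also have "\<dots> \<le> (\<Sum>l<n. \<bar>b i l\<bar>)" using that by (intro member_le_sum) auto
      also have "\<dots> \<le> B" unfolding B_def
        using that by (intro member_le_sum[of i _ "\<lambda>i. \<Sum>l<n. \<bar>b i l\<bar>"]) (auto intro: sum_nonneg)
      finally show ?thesis .
    qed
    have B0: "B \<ge> 0" unfolding B_def by (auto intro!: sum_nonneg)
    define c where "c = real n * B"
    have c0: "c \<ge> 0" unfolding c_def using B0 by simp
    define V where "V = (\<Sum>i<n. \<bar>v i\<bar>)"
    have vV: "\<bar>v i\<bar> \<le> V" if "i < n" for i
      unfolding V_def using that by (intro member_le_sum) auto
    have g_bound: "\<bar>g k j s\<bar> \<le> c * E"
      if "\<And>l. l < n \<Longrightarrow> \<bar>\<phi> k l s\<bar> \<le> E" "j < n" "\<bar>s\<bar> \<le> r" for k j s E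
    proof -
      have "\<bar>g k j s\<bar> \<le> (\<Sum>l<n. \<bar>a j l s * \<phi> k l s\<bar>)" unfolding g_def by (rule sum_abs)
      also have "\<dots> \<le> (\<Sum>l<n. B * E)"
        unfolding abs_mult using that aB B0 by (intro sum_mono mult_mono) auto
      finally show ?thesis by (simp add: c_def)
    qed
    \<comment> \<open>Each round contributes a factor \<open>c\<close> from the coefficients and
      \<open>\<bar>s\<bar> / Suc k\<close> from the integration, which builds up the
      factorial.\<close>
    have \<phi>_bound: "\<bar>\<phi> k j s\<bar> \<le> V * c ^ k / fact k * \<bar>s\<bar> ^ k" if "j < n" "\<bar>s\<bar> \<le> r" for k j s
      using that
    proof (induction k arbitrary: j s)
      case 0
      then show ?case using vV by (simp add: \<phi>_def)
    next
      case (Suc k)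
      have "\<bar>\<phi> (Suc k) j s\<bar> \<le> c * (V * c ^ k / fact k) * \<bar>s\<bar> ^ Suc k / real (Suc k)"
      proof (rule abs_primitive_le_power[OF \<phi>_0 \<phi>_deriv _ Suc.prems(2)])
        show "\<bar>g k j u\<bar> \<le> c * (V * c ^ k / fact k) * \<bar>u\<bar> ^ k" if "\<bar>u\<bar> \<le> r" for u
          using g_bound[of k u "V * c ^ k / fact k * \<bar>u\<bar> ^ k" j] Suc.IH[OF _ that] Suc.prems that
          by (simp add: mult.assoc)
      qed (use Suc.prems in auto)
      then show ?case by (simp add: field_simps)
    qed
    \<comment> \<open>The derivative of term \<open>Suc k\<close> is \<open>g k\<close> and that of
      the constant term is zero, so the majorant is the exponential series of \<open>c * r\<close>
      shifted by one.\<close>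
    define M where "M k = (case k of 0 \<Rightarrow> 0 | Suc k \<Rightarrow> c * V * ((c * r) ^ k /\<^sub>R fact k))" for k
    define \<phi>' where "\<phi>' k j s = (case k of 0 \<Rightarrow> 0 | Suc k \<Rightarrow> g k j s)" for k j s
    have V0: "V \<ge> 0" unfolding V_def by (simp add: sum_nonneg)
    have sumM: "summable M"
      by (subst summable_Suc_iff[symmetric])
        (simp only: M_def nat.case, intro summable_mult summable_exp_generic)
    have M: "norm (\<phi>' k j s) \<le> M k" if "j < n" "s \<in> {-r..r}" for k j s
    proof (cases k)
      case (Suc k')
      have s: "\<bar>s\<bar> \<le> r" using that by auto
      have "V * c ^ k' / fact k' * \<bar>s\<bar> ^ k' \<le> V * c ^ k' / fact k' * r ^ k'"
        using s V0 c0 by (intro mult_left_mono power_mono) auto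
      then have "\<bar>g k' j s\<bar> \<le> c * (V * c ^ k' / fact k' * r ^ k')"
        using g_bound[of k' s "V * c ^ k' / fact k' * r ^ k'" j] \<phi>_bound[of _ s k'] that s
        by (meson order_trans)
      then show ?thesis by (simp add: Suc \<phi>'_def M_def power_mult_distrib field_simps)
    qed (simp add: \<phi>'_def M_def)
    have series: "summable (\<lambda>k. \<phi> k j t)"
      "((\<lambda>s. \<Sum>k. \<phi> k j s) has_real_derivative (\<Sum>k. \<phi>' k j t)) (at t)" if j: "j < n" for j
    proof -
      have 1: "(\<phi> k j has_field_derivative \<phi>' k j s) (at s within {-r..r})" for k s
      proof (cases k)
        case 0
        then show ?thesis by (simp add: \<phi>_def \<phi>'_def)
      next
        case (Suc k')
        then show ?thesis
          using has_field_derivative_at_within[OF \<phi>_deriv[OF j, of k' s]] by (simp add: \<phi>'_def)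
      qed
      have 2: "uniformly_convergent_on {-r..r} (\<lambda>m s. \<Sum>k<m. \<phi>' k j s)"
        by (rule Weierstrass_m_test'[OF M sumM]) (use j in auto)
      have 3: "summable (\<lambda>k. \<phi> k j 0)"
        unfolding \<phi>_at_0[OF j] using summable_single[of 0 "\<lambda>_. v j"] by simp
      show "summable (\<lambda>k. \<phi> k j t)"
        "((\<lambda>s. \<Sum>k. \<phi> k j s) has_real_derivative (\<Sum>k. \<phi>' k j t)) (at t)"
        using has_field_derivative_series'[OF _ 1 2 _ 3 r(3)] r by auto
    qed
    have "summable (\<lambda>k. \<phi>' k i t)"
      using M[OF i r(2)] by (rule summable_comparison_test'[OF sumM])
    \<comment> \<open>Dropping the zero leading term undoes the shift, and the series of derivatives
      becomes \<open>a\<close> applied to the solution.\<close>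
    then have "(\<Sum>k. \<phi>' k i t) = (\<Sum>k. \<phi>' (Suc k) i t)"
      using suminf_split_head[of "\<lambda>k. \<phi>' k i t"] by (simp add: \<phi>'_def)
    also have "\<dots> = (\<Sum>k. \<Sum>l<n. a i l t * \<phi> k l t)" by (simp add: \<phi>'_def g_def)
    also have "\<dots> = (\<Sum>l<n. \<Sum>k. a i l t * \<phi> k l t)"
      by (rule suminf_sum) (auto intro!: summable_mult series)
    also have "\<dots> = (\<Sum>l<n. a i l t * x l t)"
      unfolding x_def by (intro sum.cong suminf_mult series) auto
    finally show ?thesis using series(2)[OF i] unfolding x_def[abs_def] by simp
  qed
  ultimately show ?thesis by blast
qed

lemma linear_ode_basis_exists:
  fixes a :: "nat \<Rightarrow> nat \<Rightarrow> real \<Rightarrow> real"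
  assumes "\<And>i j. i < n \<Longrightarrow> j < n \<Longrightarrow> continuous_on UNIV (a i j)"
  obtains x where "\<And>k i. i < n \<Longrightarrow> x k i 0 = (if i = k then 1 else 0)"
    and "\<And>k i t. i < n \<Longrightarrow> (x k i has_real_derivative (\<Sum>l<n. a i l t * x k l t)) (at t)"
proof -
  have "\<forall>k. \<exists>x. \<forall>i<n. x i 0 = (if i = k then 1 else 0) \<and>
      (\<forall>t. (x i has_real_derivative (\<Sum>l<n. a i l t * x l t)) (at t))"
    by (intro allI linear_ode_exists assms)
  from choice[OF this] show ?thesis using that by blast
qed

section \<open>Matrix solutions, the adjoint equation and uniqueness\<close>

definition has_mat_deriv :: "nat \<Rightarrow> (real \<Rightarrow> real mat) \<Rightarrow> real mat \<Rightarrow> real \<Rightarrow> bool" where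
  "has_mat_deriv n F F' t \<longleftrightarrow>
     (\<forall>i<n. \<forall>j<n. ((\<lambda>s. F s $$ (i, j)) has_real_derivative F' $$ (i, j)) (at t))"

lemma has_mat_deriv_mult:
  assumes F: "\<And>s. F s \<in> carrier_mat n n" and G: "\<And>s. G s \<in> carrier_mat n n"
    and F': "F' \<in> carrier_mat n n" and G': "G' \<in> carrier_mat n n"
    and dF: "has_mat_deriv n F F' t" and dG: "has_mat_deriv n G G' t"
  shows "has_mat_deriv n (\<lambda>s. F s * G s) (F' * G t + F t * G') t"
  unfolding has_mat_deriv_def
proof (intro allI impI)
  fix i j assume ij: "i < n" "j < n"
  have "((\<lambda>s. \<Sum>l<n. F s $$ (i, l) * G s $$ (l, j)) has_real_derivative
      (\<Sum>l<n. F' $$ (i, l) * G t $$ (l, j) + G' $$ (l, j) * F t $$ (i, l))) (at t)"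
    using dF dG ij unfolding has_mat_deriv_def by (intro DERIV_sum DERIV_mult) auto
  moreover have "(F' * G t + F t * G') $$ (i, j)
      = (\<Sum>l<n. F' $$ (i, l) * G t $$ (l, j) + G' $$ (l, j) * F t $$ (i, l))"
    using ij F[of t] G[of t] F' G'
    by (simp add: mult_mat_index_sum[of _ n n _ n] sum.distrib mult.commute del: index_mult_mat(1))
  ultimately show "((\<lambda>s. (F s * G s) $$ (i, j)) has_real_derivative (F' * G t + F t * G') $$ (i, j)) (at t)"
    using ij by (simp add: mult_mat_index_sum[OF F G] del: index_mult_mat(1))
qed

lemma has_mat_deriv_zero_imp_const:
  assumes F: "\<And>s. F s \<in> carrier_mat n n" and d: "\<And>s. has_mat_deriv n F (0\<^sub>m n n) s"
  shows "F t = F 0"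
proof (rule eq_matI)
  fix i j assume "i < dim_row (F 0)" "j < dim_col (F 0)"
  then have ij: "i < n" "j < n" using F[of 0] by auto
  have "((\<lambda>s. F s $$ (i, j)) has_real_derivative 0) (at s)" for s
    using d[of s] ij unfolding has_mat_deriv_def by auto
  then show "F t $$ (i, j) = F 0 $$ (i, j)" by (intro DERIV_isconst_all) auto
qed (use F[of 0] F[of t] in auto)

lemma has_mat_deriv_shift:
  assumes "has_mat_deriv n F F' (t + c)"
  shows "has_mat_deriv n (\<lambda>s. F (s + c)) F' t"
  using assms unfolding has_mat_deriv_def by (auto simp: DERIV_shift)

lemma has_mat_deriv_const_mult:
  assumes F: "\<And>s. F s \<in> carrier_mat n n" and F': "F' \<in> carrier_mat n n" and C: "C \<in> carrier_mat n n"
    and dF: "has_mat_deriv n F F' t"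
  shows "has_mat_deriv n (\<lambda>s. F s * C) (F' * C) t"
proof -
  have "has_mat_deriv n (\<lambda>s. C) (0\<^sub>m n n) t" unfolding has_mat_deriv_def by auto
  from has_mat_deriv_mult[OF F C F' zero_carrier_mat dF this]
  show ?thesis using F[of t] F' C by simp
qed

lemma det_nonzero_of_left_inverse:
  fixes A :: "'a::field mat"
  assumes "A \<in> carrier_mat n n" "B \<in> carrier_mat n n" "B * A = 1\<^sub>m n"
  shows "det A \<noteq> 0"
  using det_mult[OF assms(2,1)] assms(3) by auto

text \<open>Covers the given system as well as the constant one of a single matrix \<open>R\<close>,
  from which the functional equation of the exponential is obtained.\<close>

locale linear_system =
  fixes n :: nat and A :: "real \<Rightarrow> real mat"
  assumes A: "A t \<in> carrier_mat n n"
    and cont: "i < n \<Longrightarrow> j < n \<Longrightarrow> continuous_on UNIV (\<lambda>t. A t $$ (i, j))"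
begin

text \<open>The rows of \<Psi> solve the system with the negated transpose of \<open>A\<close> as
  coefficient matrix, hence the exchanged indices.\<close>

lemma adjoint_exists:
  "\<exists>\<Psi>. (\<forall>t. \<Psi> t \<in> carrier_mat n n) \<and> \<Psi> 0 = 1\<^sub>m n \<and> (\<forall>t. has_mat_deriv n \<Psi> (- (\<Psi> t * A t)) t)"
proof -
  have "continuous_on UNIV (\<lambda>t. - A t $$ (j, i))" if "i < n" "j < n" for i j
    using continuous_on_minus[OF cont] that by blast
  then obtain y where y: "\<And>k i. i < n \<Longrightarrow> y k i 0 = (if i = k then 1 else 0)"
    "\<And>k i t. i < n \<Longrightarrow> (y k i has_real_derivative (\<Sum>l<n. - A t $$ (l, i) * y k l t)) (at t)"
    using linear_ode_basis_exists[of n "\<lambda>i j t. - A t $$ (j, i)"] by blast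
  define \<Psi> where "\<Psi> t = mat n n (\<lambda>(k, i). y k i t)" for t
  have \<Psi>: "\<Psi> t \<in> carrier_mat n n" for t by (simp add: \<Psi>_def)
  have "has_mat_deriv n \<Psi> (- (\<Psi> t * A t)) t" for t
    unfolding has_mat_deriv_def
  proof (intro allI impI)
    fix k i assume ki: "k < n" "i < n"
    have "(- (\<Psi> t * A t)) $$ (k, i) = (\<Sum>l<n. - A t $$ (l, i) * y k l t)"
      using ki \<Psi>[of t] A[of t]
      by (simp add: mult_mat_index_sum[of _ n n _ n] \<Psi>_def sum_negf mult.commute del: index_mult_mat(1))
    then show "((\<lambda>s. \<Psi> s $$ (k, i)) has_real_derivative (- (\<Psi> t * A t)) $$ (k, i)) (at t)"
      using y(2)[OF ki(2), of k t] ki by (simp add: \<Psi>_def)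
  qed
  moreover have "\<Psi> 0 = 1\<^sub>m n" by (rule eq_matI) (auto simp: \<Psi>_def y(1))
  ultimately show ?thesis using \<Psi> by blast
qed

text \<open>In the product rule the two terms \<open>- \<Psi> A \<Phi>\<close> and
  \<open>\<Psi> A \<Phi>\<close> cancel.\<close>

lemma adjoint_mult_solution_const:
  assumes \<Psi>: "\<And>t. \<Psi> t \<in> carrier_mat n n" "\<And>t. has_mat_deriv n \<Psi> (- (\<Psi> t * A t)) t"
    and \<Phi>: "\<And>t. \<Phi> t \<in> carrier_mat n n" "\<And>t. has_mat_deriv n \<Phi> (A t * \<Phi> t) t"
  shows "\<Psi> t * \<Phi> t = \<Psi> 0 * \<Phi> 0"
proof (rule has_mat_deriv_zero_imp_const)
  show "\<Psi> s * \<Phi> s \<in> carrier_mat n n" for s using \<Psi>(1)[of s] \<Phi>(1)[of s] by auto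
  fix s
  note car = \<Psi>(1)[of s] \<Phi>(1)[of s] A[of s]
  have "has_mat_deriv n (\<lambda>s. \<Psi> s * \<Phi> s) (- (\<Psi> s * A s) * \<Phi> s + \<Psi> s * (A s * \<Phi> s)) s"
    by (rule has_mat_deriv_mult[OF \<Psi>(1) \<Phi>(1) _ _ \<Psi>(2) \<Phi>(2)]) (use car in auto)
  moreover have "- (\<Psi> s * A s) * \<Phi> s + \<Psi> s * (A s * \<Phi> s) = 0\<^sub>m n n"
  proof -
    have 1: "- (\<Psi> s * A s) * \<Phi> s = - (\<Psi> s * A s * \<Phi> s)" using car by simp
    have 2: "\<Psi> s * (A s * \<Phi> s) = \<Psi> s * A s * \<Phi> s"
      using car by (simp add: assoc_mult_mat[of _ n n _ n _ n])
    have 3: "\<Psi> s * A s * \<Phi> s \<in> carrier_mat n n" using car by auto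
    show ?thesis unfolding 1 2 by (rule uminus_l_inv_mat[OF 3])
  qed
  ultimately show "has_mat_deriv n (\<lambda>s. \<Psi> s * \<Phi> s) (0\<^sub>m n n) s" by simp
qed

lemma solution_exists:
  "\<exists>\<Phi>. (\<forall>t. \<Phi> t \<in> carrier_mat n n) \<and> \<Phi> 0 = 1\<^sub>m n \<and> (\<forall>t. has_mat_deriv n \<Phi> (A t * \<Phi> t) t)"
proof -
  obtain x where x: "\<And>k i. i < n \<Longrightarrow> x k i 0 = (if i = k then 1 else 0)"
    "\<And>k i t. i < n \<Longrightarrow> (x k i has_real_derivative (\<Sum>l<n. A t $$ (i, l) * x k l t)) (at t)"
    using linear_ode_basis_exists[of n "\<lambda>i j t. A t $$ (i, j)"] cont by blast
  define \<Phi> where "\<Phi> t = mat n n (\<lambda>(i, k). x k i t)" for t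
  have \<Phi>: "\<Phi> t \<in> carrier_mat n n" for t by (simp add: \<Phi>_def)
  have "has_mat_deriv n \<Phi> (A t * \<Phi> t) t" for t
    unfolding has_mat_deriv_def
  proof (intro allI impI)
    fix i k assume ik: "i < n" "k < n"
    have "(A t * \<Phi> t) $$ (i, k) = (\<Sum>l<n. A t $$ (i, l) * x k l t)"
      using ik by (subst mult_mat_index_sum[OF A \<Phi> ik]) (simp add: \<Phi>_def)
    then show "((\<lambda>s. \<Phi> s $$ (i, k)) has_real_derivative (A t * \<Phi> t) $$ (i, k)) (at t)"
      using x(2)[OF ik(1), of k t] ik by (simp add: \<Phi>_def)
  qed
  moreover have "\<Phi> 0 = 1\<^sub>m n" by (rule eq_matI) (auto simp: \<Phi>_def x(1))
  ultimately show ?thesis using \<Phi> by blast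
qed

lemma fundamental_matrix_iff:
  "fundamental_matrix n A \<Phi> \<longleftrightarrow>
     (\<forall>t. \<Phi> t \<in> carrier_mat n n \<and> det (\<Phi> t) \<noteq> 0 \<and> has_mat_deriv n \<Phi> (A t * \<Phi> t) t)"
  unfolding fundamental_matrix_def has_mat_deriv_def ..

text \<open>The product with the solution starting at the identity is constantly the identity, so
  neither factor can become singular.\<close>

lemma adjoint_invertible:
  assumes \<Psi>: "\<And>t. \<Psi> t \<in> carrier_mat n n" "\<And>t. has_mat_deriv n \<Psi> (- (\<Psi> t * A t)) t" "\<Psi> 0 = 1\<^sub>m n"
  shows "\<exists>\<Phi>. fundamental_matrix n A \<Phi> \<and> (\<forall>t. \<Psi> t * \<Phi> t = 1\<^sub>m n)"
proof -
  obtain \<Phi> where \<Phi>: "\<And>t. \<Phi> t \<in> carrier_mat n n" "\<Phi> 0 = 1\<^sub>m n"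
    "\<And>t. has_mat_deriv n \<Phi> (A t * \<Phi> t) t"
    using solution_exists by blast
  have inv: "\<Psi> t * \<Phi> t = 1\<^sub>m n" for t
    using adjoint_mult_solution_const[OF \<Psi>(1,2) \<Phi>(1,3), of t] \<Psi>(3) \<Phi>(2) by simp
  then have "det (\<Phi> t) \<noteq> 0" for t by (rule det_nonzero_of_left_inverse[OF \<Phi>(1) \<Psi>(1)])
  with \<Phi> inv show ?thesis
    unfolding fundamental_matrix_iff by (intro exI[of _ \<Phi>] conjI allI)
qed

lemma fundamental_matrix_exists: "\<exists>\<Phi>. fundamental_matrix n A \<Phi>"
proof -
  obtain \<Psi> where \<Psi>: "\<And>t. \<Psi> t \<in> carrier_mat n n" "\<Psi> 0 = 1\<^sub>m n"
    "\<And>t. has_mat_deriv n \<Psi> (- (\<Psi> t * A t)) t"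
    using adjoint_exists by blast
  show ?thesis using adjoint_invertible[OF \<Psi>(1,3,2)] by blast
qed

text \<open>Multiplication by an adjoint solution \<Psi> reduces \<open>X t\<close> and
  \<open>\<Phi> t\<close> to their values at zero, where the relation is assumed; then \<Psi> is
  cancelled by its inverse \<Theta>.\<close>

lemma solution_eq_fundamental_mult:
  assumes \<Phi>: "fundamental_matrix n A \<Phi>"
    and X: "\<And>t. X t \<in> carrier_mat n n" "\<And>t. has_mat_deriv n X (A t * X t) t"
    and C: "C \<in> carrier_mat n n" "X 0 = \<Phi> 0 * C"
  shows "X t = \<Phi> t * C"
proof -
  obtain \<Psi> where \<Psi>: "\<And>t. \<Psi> t \<in> carrier_mat n n" "\<Psi> 0 = 1\<^sub>m n"
    "\<And>t. has_mat_deriv n \<Psi> (- (\<Psi> t * A t)) t"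
    using adjoint_exists by blast
  obtain \<Theta> where \<Theta>: "fundamental_matrix n A \<Theta>" "\<And>t. \<Psi> t * \<Theta> t = 1\<^sub>m n"
    using adjoint_invertible[OF \<Psi>(1,3,2)] by blast
  have c\<Phi>: "\<Phi> t \<in> carrier_mat n n" and d\<Phi>: "has_mat_deriv n \<Phi> (A t * \<Phi> t) t" for t
    using \<Phi> unfolding fundamental_matrix_iff by auto
  have c\<Theta>: "\<Theta> t \<in> carrier_mat n n" for t using \<Theta>(1) unfolding fundamental_matrix_iff by auto
  have \<Theta>\<Psi>: "\<Theta> t * \<Psi> t = 1\<^sub>m n" by (rule mat_mult_left_right_inverse[OF \<Psi>(1) c\<Theta> \<Theta>(2)])
  have cancel: "Y = \<Theta> t * (\<Psi> t * Y)" if "Y \<in> carrier_mat n n" for Y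
    using assoc_mult_mat[OF c\<Theta>[of t] \<Psi>(1)[of t] that] \<Theta>\<Psi> that by simp
  have "\<Psi> t * X t = X 0" and "\<Psi> t * \<Phi> t = \<Phi> 0"
    using adjoint_mult_solution_const[OF \<Psi>(1,3) X, of t] X(1)[of 0]
      adjoint_mult_solution_const[OF \<Psi>(1,3) c\<Phi> d\<Phi>, of t] c\<Phi>[of 0] \<Psi>(2) by simp_all
  then have eq: "\<Psi> t * X t = \<Psi> t * (\<Phi> t * C)"
    using C(2) assoc_mult_mat[OF \<Psi>(1)[of t] c\<Phi>[of t] C(1)] by simp
  have "X t = \<Theta> t * (\<Psi> t * X t)" by (rule cancel[OF X(1)])
  also have "\<dots> = \<Phi> t * C"
    unfolding eq by (rule cancel[OF mult_carrier_mat[OF c\<Phi> C(1)], symmetric])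
  finally show ?thesis .
qed

end

section \<open>The exponential as a solution with constant coefficients\<close>

text \<open>Termwise differentiation raises the power of \<open>R\<close> by one, and the extra
  factor can be taken out on either side. The left form fits the system itself, the right form its
  adjoint.\<close>

lemma has_mat_deriv_mexp:
  fixes R :: "real mat"
  assumes R: "R \<in> carrier_mat n n"
  shows "has_mat_deriv n (\<lambda>s. mexp s R) (R * mexp t R) t"
    and "has_mat_deriv n (\<lambda>s. mexp s R) (mexp t R * R) t"
proof -
  have main: "((\<lambda>s. mexp s R $$ (i, j)) has_real_derivative D) (at t)"
    if ij: "i < n" "j < n" and D: "(\<lambda>k. (t ^ k / fact k) *\<^sub>R (R ^\<^sub>m Suc k) $$ (i, j)) sums D"
    for i j D
  proof -
    define c where "c k = (R ^\<^sub>m k) $$ (i, j) / fact k" for k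
    have c: "(s ^ k / fact k) *\<^sub>R (R ^\<^sub>m k) $$ (i, j) = c k * s ^ k" for s k
      by (simp add: c_def)
    have "((\<lambda>s. \<Sum>k. c k * s ^ k) has_real_derivative (\<Sum>k. diffs c k * t ^ k)) (at t)"
      using mexp_summable[OF R ij] unfolding c by (rule termdiffs_strong_converges_everywhere)
    moreover have "mexp s R $$ (i, j) = (\<Sum>k. c k * s ^ k)" for s
      using sums_unique[OF mexp_sums[OF R ij, of s]] unfolding c .
    moreover have "diffs c k * t ^ k = (t ^ k / fact k) *\<^sub>R (R ^\<^sub>m Suc k) $$ (i, j)" for k
      by (simp add: diffs_def c_def del: pow_mat.simps of_nat_Suc)
    then have "(\<Sum>k. diffs c k * t ^ k) = D" using sums_unique[OF D] by simp
    ultimately show ?thesis by simp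
  qed
  show "has_mat_deriv n (\<lambda>s. mexp s R) (R * mexp t R) t"
    unfolding has_mat_deriv_def
  proof (intro allI impI main)
    fix i j assume ij: "i < n" "j < n"
    show "(\<lambda>k. (t ^ k / fact k) *\<^sub>R (R ^\<^sub>m Suc k) $$ (i, j)) sums ((R * mexp t R) $$ (i, j))"
      unfolding pow_mat_Suc_left[OF R]
      by (intro sums_mult_mat_left[OF R _ _ _ ij] mexp_sums[OF R]) (use R in auto)
  qed
  show "has_mat_deriv n (\<lambda>s. mexp s R) (mexp t R * R) t"
    unfolding has_mat_deriv_def
  proof (intro allI impI main)
    fix i j assume ij: "i < n" "j < n"
    show "(\<lambda>k. (t ^ k / fact k) *\<^sub>R (R ^\<^sub>m Suc k) $$ (i, j)) sums ((mexp t R * R) $$ (i, j))"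
      unfolding pow_mat.simps
      by (intro sums_mult_mat_right[OF R _ _ _ ij] mexp_sums[OF R]) (use R in auto)
  qed
qed

text \<open>As functions of \<open>t\<close>, the first factor solves the adjoint equation and the
  second the equation itself. Their product is therefore constant and equals its value at
  zero.\<close>

lemma mexp_minus_mult_mexp_add:
  fixes R :: "real mat"
  assumes R: "R \<in> carrier_mat n n"
  shows "mexp (- t) R * mexp (t + s) R = mexp s R"
proof -
  interpret linear_system n "\<lambda>_. R"
    by unfold_locales (use R in auto)
  have minus: "has_mat_deriv n (\<lambda>t. mexp (- t) R) (- (mexp (- t) R * R)) t" for t
    unfolding has_mat_deriv_def
  proof (intro allI impI)
    fix i j assume ij: "i < n" "j < n"
    have "((\<lambda>t. mexp t R $$ (i, j)) has_real_derivative (mexp (- t) R * R) $$ (i, j)) (at (- t))"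
      using has_mat_deriv_mexp(2)[OF R, of "- t"] ij unfolding has_mat_deriv_def by blast
    then have "((\<lambda>t. mexp (- t) R $$ (i, j)) has_real_derivative - (mexp (- t) R * R) $$ (i, j)) (at t)"
      by (simp only: DERIV_mirror)
    moreover have "(- (mexp (- t) R * R)) $$ (i, j) = - (mexp (- t) R * R) $$ (i, j)"
      using ij R by simp
    ultimately show "((\<lambda>t. mexp (- t) R $$ (i, j)) has_real_derivative (- (mexp (- t) R * R)) $$ (i, j)) (at t)"
      by (simp only:)
  qed
  have "mexp (- t) R * mexp (t + s) R = mexp (- 0) R * mexp (0 + s) R"
  proof (rule adjoint_mult_solution_const[of "\<lambda>t. mexp (- t) R" "\<lambda>t. mexp (t + s) R" t])
    show "has_mat_deriv n (\<lambda>t. mexp (- t) R) (- (mexp (- u) R * R)) u" for u by (rule minus)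
    show "has_mat_deriv n (\<lambda>t. mexp (t + s) R) (R * mexp (u + s) R) u" for u
      using has_mat_deriv_shift[of n "\<lambda>t. mexp t R" "R * mexp (u + s) R" u s]
        has_mat_deriv_mexp(1)[OF R, of "u + s"] by simp
  qed (use R in auto)
  then show ?thesis using R by (simp add: mexp_0)
qed

section \<open>The monodromy matrix and the Floquet factorisation\<close>

lemma monodromy:
  assumes \<Phi>: "\<And>t. \<Phi> t \<in> carrier_mat n n" and det: "det (\<Phi> 0) \<noteq> 0"
  shows "monodromy n \<Phi> T \<in> carrier_mat n n" "\<Phi> 0 * monodromy n \<Phi> T = \<Phi> T"
proof -
  obtain G where G: "G \<in> carrier_mat n n" "\<Phi> 0 * G = 1\<^sub>m n" "G * \<Phi> 0 = 1\<^sub>m n"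
    using mat_inverse_exists[OF \<Phi> det] by blast
  have "\<exists>!M. M \<in> carrier_mat n n \<and> \<Phi> 0 * M = \<Phi> T"
  proof (rule ex1I[of _ "G * \<Phi> T"])
    show "G * \<Phi> T \<in> carrier_mat n n \<and> \<Phi> 0 * (G * \<Phi> T) = \<Phi> T"
      using assoc_mult_mat[OF \<Phi>[of 0] G(1) \<Phi>[of T]] G \<Phi>[of T] by auto
    show "M = G * \<Phi> T" if "M \<in> carrier_mat n n \<and> \<Phi> 0 * M = \<Phi> T" for M
      using assoc_mult_mat[OF G(1) \<Phi>[of 0], of M n] that G by auto
  qed
  from theI'[OF this] show "monodromy n \<Phi> T \<in> carrier_mat n n" "\<Phi> 0 * monodromy n \<Phi> T = \<Phi> T"
    unfolding monodromy_def by auto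
qed

lemma sign_block_eq_dirsum: "sign_block n d = dirsum (1\<^sub>m (n - d)) (- 1\<^sub>m d)"
  unfolding sign_block_def dirsum_def by simp

theorem theoremA:
  fixes n :: nat and T :: real and A :: "real \<Rightarrow> real mat" and d :: nat
  assumes "T > 0"
    and "\<forall>t. A t \<in> carrier_mat n n"
    and "\<forall>i<n. \<forall>j<n. continuous_on UNIV (\<lambda>t. A t $$ (i,j))"
    and "\<forall>t. A (t + T) = A t"
    and "d = A_index n A T"
  shows "\<exists>R Q. R \<in> carrier_mat n n \<and> (\<forall>t. Q t \<in> carrier_mat n n) \<and>
           fundamental_matrix n A (\<lambda>t. Q t * mat_exp_t n t R) \<and>
           (\<forall>t. Q (t + T) = Q t * sign_block n d)"
proof -
  interpret linear_system n A
    by unfold_locales (use assms(2,3) in auto)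
  \<comment> \<open>The same choice as in \<open>A_index\<close>, so \<open>d\<close> is the index
    of the monodromy matrix \<open>M\<close> of this very \<Phi>.\<close>
  define \<Phi> where "\<Phi> = (SOME \<Phi>. fundamental_matrix n A \<Phi>)"
  have fund: "fundamental_matrix n A \<Phi>"
    unfolding \<Phi>_def by (rule someI_ex[OF fundamental_matrix_exists])
  have \<Phi>: "\<Phi> t \<in> carrier_mat n n" and det\<Phi>: "det (\<Phi> t) \<noteq> 0"
    and d\<Phi>: "has_mat_deriv n \<Phi> (A t * \<Phi> t) t" for t
    using fund unfolding fundamental_matrix_iff by auto
  define M where "M = monodromy n \<Phi> T"
  have M: "M \<in> carrier_mat n n" "\<Phi> 0 * M = \<Phi> T"
    unfolding M_def using monodromy[of \<Phi> n T, OF \<Phi> det\<Phi>] by auto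
  have detM: "det M \<noteq> 0" using det_mult[OF \<Phi>[of 0] M(1)] det\<Phi>[of T] M(2) by auto
  have d: "d = aindex_mat M" using assms(5) unfolding A_index_def M_def \<Phi>_def .
  \<comment> \<open>By periodicity the shifted function solves the same system, and its value at
    zero is \<open>\<Phi> 0 * M\<close>.\<close>
  have floquet: "\<Phi> (t + T) = \<Phi> t * M" for t
  proof (rule solution_eq_fundamental_mult[OF fund _ _ M(1)])
    show "has_mat_deriv n (\<lambda>s. \<Phi> (s + T)) (A s * \<Phi> (s + T)) s" for s
      using has_mat_deriv_shift[OF d\<Phi>[of "s + T"]] assms(4) by simp
  qed (use \<Phi> M in auto)
  obtain R1 R2 where dn: "d \<le> n" and R1: "R1 \<in> carrier_mat (n - d) (n - d)"
    and R2: "R2 \<in> carrier_mat d d"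
    and sim: "similar_mat M (dirsum (mexp T R1) (- mexp T R2))"
    using similar_mexp_dirsum_minus_mexp[OF M(1) detM, of T] assms(1) unfolding d by auto
  define R where "R = dirsum R1 R2"
  have R: "R \<in> carrier_mat n n"
    using dirsum_carrier_mat[OF R1 R2] dn by (simp add: R_def)
  define S where "S = sign_block n d"
  have S: "S \<in> carrier_mat n n"
    unfolding S_def sign_block_eq_dirsum
    using dirsum_carrier_mat[of "1\<^sub>m (n - d)" "n - d" "- 1\<^sub>m d" d] dn by auto
  have E: "mexp t R \<in> carrier_mat n n" for t using R by auto
  have mE: "mexp t R = dirsum (mexp t R1) (mexp t R2)" for t
    unfolding R_def by (rule mexp_dirsum[OF R1 R2])
  \<comment> \<open>\<open>S\<close> commutes with the exponential: both are block diagonal for the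
    same splitting, and \<open>S\<close> is plus or minus the identity on each block.\<close>
  have S_mult: "S * mexp t R = dirsum (mexp t R1) (- mexp t R2)"
    and mult_S: "mexp t R * S = dirsum (mexp t R1) (- mexp t R2)" for t
  proof -
    have E1: "mexp t R1 \<in> carrier_mat (n - d) (n - d)" and E2: "mexp t R2 \<in> carrier_mat d d"
      using R1 R2 by auto
    have 1: "- 1\<^sub>m d \<in> carrier_mat d d" by simp
    show "S * mexp t R = dirsum (mexp t R1) (- mexp t R2)"
      unfolding S_def sign_block_eq_dirsum mE dirsum_mult[OF one_carrier_mat E1 1 E2]
      using E1 E2 R1 R2 by simp
    show "mexp t R * S = dirsum (mexp t R1) (- mexp t R2)"
      unfolding S_def sign_block_eq_dirsum mE dirsum_mult[OF E1 one_carrier_mat E2 1]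
      using E1 E2 R1 R2 by simp
  qed
  obtain W W' where "similar_mat_wit M (S * mexp T R) W W'"
    using sim unfolding S_mult similar_mat_def by blast
  note w = similar_mat_witD2[OF M(1) this]
  have WN: "W * (S * mexp T R) \<in> carrier_mat n n" using w(5,6) by (rule mult_carrier_mat[rotated])
  have "M * W = W * (S * mexp T R) * (W' * W)"
    unfolding w(3) by (rule assoc_mult_mat[OF WN w(7,6)])
  also have "\<dots> = W * (S * mexp T R)" unfolding w(2) by (rule right_mult_one_mat[OF WN])
  finally have MW: "M * W = W * (S * mexp T R)" .
  \<comment> \<open>The fundamental matrix \<Phi> in a new basis, chosen so that its monodromy
    becomes \<open>S * mexp T R\<close>.\<close>
  define X where "X t = \<Phi> t * W" for t
  have X: "X t \<in> carrier_mat n n" for t unfolding X_def using \<Phi>[of t] w(6) by auto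
  have fundX: "fundamental_matrix n A X"
    unfolding fundamental_matrix_iff
  proof (intro allI conjI X)
    fix t
    have "det W \<noteq> 0" by (rule det_nonzero_of_left_inverse[OF w(6,7,2)])
    then show "det (X t) \<noteq> 0" unfolding X_def using det_mult[OF \<Phi>[of t] w(6)] det\<Phi>[of t] by simp
    have "has_mat_deriv n X (A t * \<Phi> t * W) t"
      unfolding X_def[abs_def]
      by (rule has_mat_deriv_const_mult[OF \<Phi> _ w(6) d\<Phi>]) (use A[of t] \<Phi>[of t] in auto)
    then show "has_mat_deriv n X (A t * X t) t"
      unfolding X_def using assoc_mult_mat[OF A[of t] \<Phi>[of t] w(6)] by simp
  qed
  define Q where "Q t = X t * mexp (- t) R" for t
  have "Q t * mat_exp_t n t R = X t" for t
  proof -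
    have "mexp (- t) R * mexp t R = 1\<^sub>m n"
      using mexp_minus_mult_mexp_add[OF R, of t 0] by (simp add: mexp_0[OF R])
    then show ?thesis
      unfolding Q_def mat_exp_t_eq_mexp[OF R] using X[of t] assoc_mult_mat[OF X[of t] E[of "- t"] E[of t]] by simp
  qed
  then have "fundamental_matrix n A (\<lambda>t. Q t * mat_exp_t n t R)" using fundX by simp
  moreover have "Q (t + T) = Q t * S" for t
  proof -
    have "X (t + T) = \<Phi> t * (M * W)"
      unfolding X_def floquet using assoc_mult_mat[OF \<Phi>[of t] M(1) w(6)] .
    also have "\<dots> = X t * (S * mexp T R)"
      unfolding MW X_def by (rule assoc_mult_mat[OF \<Phi> w(6,5), symmetric])
    finally have "Q (t + T) = X t * (S * mexp T R) * mexp (- (t + T)) R" by (simp add: Q_def)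
    also have "\<dots> = X t * (S * (mexp T R * mexp (- T + - t) R))"
      using X[of t] S E[of T] E[of "- (t + T)"] 
      by (simp add: assoc_mult_mat[of _ n n _ n _ n] add.commute)
    \<comment> \<open>The exponential over one period cancels, leaving only \<open>S\<close>, which
      is then moved to the right by commutation.\<close>
    also have "mexp T R * mexp (- T + - t) R = mexp (- t) R"
      using mexp_minus_mult_mexp_add[OF R, of "- T" "- t"] by simp
    also have "S * mexp (- t) R = mexp (- t) R * S" unfolding S_mult mult_S ..
    also have "X t * (mexp (- t) R * S) = Q t * S"
      unfolding Q_def using assoc_mult_mat[OF X[of t] E[of "- t"] S] by simp
    finally show ?thesis .
  qed
  moreover have "Q t \<in> carrier_mat n n" for t unfolding Q_def using X[of t] E[of "- t"] by auto
  ultimately show ?thesis using R unfolding S_def by blast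
qed

end
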